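(* Let $\mathcal{D}$ be a datum of Cartan type $A_n$ and $1\le i<j\le n+1$. For all $(i_1,\dots,i_r)\in I_{ij}$ define $$t(i_1,\dots,i_r)=(-1)^{j-i-r+1}(q-1)^{N(r-2)}\,\tau(i_1,\dots,i_r)^{-\frac{N-1}{2}}\,\tau_{ij}^{\frac{N+1}{2}}.$$ Then in $R=R(\mathcal{D})$ $$x_{ji}^N=\sum_{(i_1,\dots,i_r)\in I_{ij}}t(i_1,\dots,i_r)\,x_{i_1i_2}^N x_{i_2i_3}^N\cdots x_{i_{r-1}i_r}^N.$$
   Context: $\mathbf{k}$ is an algebraically closed field of characteristic $0$. Let $n\ge 2$ and let $(a_{ij})_{1\le i,j\le n}$ be the Cartan matrix of type $A_n$: $a_{ii}=2$, $a_{ij}=-1$ if $|i-j|=1$, $a_{ij}=0$ if $|i-j|>1$. A datum of Cartan type $A_n$, $\mathcal{D}$, consists of a finite abelian group $\Gamma$, elements $g_1,\dots,g_n\in\Gamma$ and characters $\chi_1,\dots,\chi_n:\Gamma\to\mathbf{k}^\times$ such that, with $q_{ij}=\chi_j(g_i)$, there is a root of unity $q\in\mathbf{k}$ of order $N>1$, with $N$ odd, such that $q_{ii}=q$ for all $i$, $q_{ij}q_{ji}=q^{-1}$ if $|i-j|=1$, and $q_{ij}q_{ji}=1$ if $|i-j|>1$. $R(\mathcal{D})$ is the algebra generated by $x_1,\dots,x_n$ with relations $\mathrm{ad}_c(x_i)^{1-a_{ij}}(x_j)=0$ for all $i\ne j$, where $\mathrm{ad}_c(x_i)(x_{j_1}\cdots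 x_{j_s})=x_ix_{j_1}\cdots x_{j_s}-q_{ij_1}\cdots q_{ij_s}x_{j_1}\cdots x_{j_s}x_i$. Put $\chi_{ij}=\prod_{i\le l<j}\chi_l$ for $i<j$. For $1\le i<j\le n+1$, the root vectors $x_{ij}$ are defined by $x_{i,i+1}=x_i$ and $x_{ij}=x_ix_{i+1,j}-\chi_{i+1,j}(g_i)\,x_{i+1,j}x_i$ if $j-i>1$; the reverse root vectors $x_{ji}$ are defined by $x_{i+1,i}=x_i$ and $x_{ji}=x_{j-1}x_{j-1,i}-\chi_{i,j-1}(g_{j-1})\,x_{j-1,i}x_{j-1}$ if $j-i>1$. $I_{ij}=\{(i_1,\dots,i_r)\mid r\ge2,\ i=i_1<i_2<\dots<i_r=j\}$; $\tau_{ij}=\prod_{i\le k<l<j}q_{lk}^N$ (empty product $=1$); $\tau(i_1,\dots,i_r)=\tau_{i_1i_2}\tau_{i_2i_3}\cdots\tau_{i_{r-1}i_r}$. *)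

theory Defs
  imports
    "HOL-Algebra.QuotRing"
    "HOL-Algebra.Module"
    "HOL-Library.Poly_Mapping"
    "HOL-Computational_Algebra.Polynomial"
begin

section \<open>The free algebra\<close>

text \<open>
  The free monoid, written additively: for a \<^class>\<open>monoid_add\<close> index type the
  product on \<^type>\<open>poly_mapping\<close> is convolution, so finitely supported functions on words
  are the noncommutative polynomials.
\<close>

datatype nc_word = NC_Word (letters: "nat list")

instantiation nc_word :: monoid_add
begin

definition zero_nc_word :: nc_word
  where "0 = NC_Word []"

definition plus_nc_word :: "nc_word \<Rightarrow> nc_word \<Rightarrow> nc_word"
  where "u + v = NC_Word (letters u @ letters v)"

instance
  by standard (simp_all add: zero_nc_word_def plus_nc_word_def)

end

type_synonym 'k ncpoly = "nc_word \<Rightarrow>\<^sub>0 'k"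

definition scalar :: "'k::field \<Rightarrow> 'k ncpoly"
  where "scalar c = Poly_Mapping.single 0 c"

definition word_poly :: "nat list \<Rightarrow> 'k::field ncpoly"
  where "word_poly w = Poly_Mapping.single (NC_Word w) 1"

definition xvar :: "nat \<Rightarrow> 'k::field ncpoly"
  where "xvar i = word_poly [i]"

definition free_algebra :: "nat \<Rightarrow> ('k::field ncpoly) ring"
  where "free_algebra n =
    \<lparr>carrier = {f. \<forall>w\<in>Poly_Mapping.keys f. set (letters w) \<subseteq> {1..n}},
     monoid.mult = (*), one = 1, zero = 0, add = (+)\<rparr>"


section \<open>Data of Cartan type A\<close>

definition cartan_A :: "nat \<Rightarrow> nat \<Rightarrow> int"
  where "cartan_A i j =
    (if i = j then 2 else if i = Suc j \<or> j = Suc i then -1 else 0)"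

definition units_group :: "'k::field monoid"
  where "units_group = \<lparr>carrier = {c. c \<noteq> 0}, monoid.mult = (*), one = 1\<rparr>"

text \<open>Only the values of \<open>datum_elt\<close> and \<open>datum_chr\<close> at the indices \<open>1, \<dots>, datum_rank\<close> are relevant.\<close>

record ('g, 'k) datum =
  datum_rank :: nat
  datum_group :: "'g monoid"
  datum_elt :: "nat \<Rightarrow> 'g"
  datum_chr :: "nat \<Rightarrow> 'g \<Rightarrow> 'k"

definition braiding :: "('g, 'k::field) datum \<Rightarrow> nat \<Rightarrow> nat \<Rightarrow> 'k"
  where "braiding D i j = datum_chr D j (datum_elt D i)"

definition root_of_unity_of_order :: "'k::field \<Rightarrow> nat \<Rightarrow> bool"
  where "root_of_unity_of_order q N \<longleftrightarrow> 0 < N \<and> q ^ N = 1 \<and> (\<forall>m. 0 < m \<and> m < N \<longrightarrow> q ^ m \<noteq> 1)"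

text \<open>
  The root of unity \<open>q\<close> and its order \<open>N\<close> are uniquely determined by the datum, since
  \<open>q\<close> is the diagonal entry of the braiding.
\<close>

definition datum_of_type_A :: "('g, 'k::field) datum \<Rightarrow> 'k \<Rightarrow> nat \<Rightarrow> bool"
  where "datum_of_type_A D q N \<longleftrightarrow>
    2 \<le> datum_rank D \<and>
    comm_group (datum_group D) \<and> finite (carrier (datum_group D)) \<and>
    (\<forall>i\<in>{1..datum_rank D}. datum_elt D i \<in> carrier (datum_group D)) \<and>
    (\<forall>i\<in>{1..datum_rank D}. datum_chr D i \<in> hom (datum_group D) units_group) \<and>
    root_of_unity_of_order q N \<and> 1 < N \<and> odd N \<and>
    (\<forall>i\<in>{1..datum_rank D}. braiding D i i = q) \<and>
    (\<forall>i\<in>{1..datum_rank D}. \<forall>j\<in>{1..datum_rank D}. i = Suc j \<or> j = Suc i \<longrightarrow>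
       braiding D i j * braiding D j i = inverse q) \<and>
    (\<forall>i\<in>{1..datum_rank D}. \<forall>j\<in>{1..datum_rank D}. Suc i < j \<or> Suc j < i \<longrightarrow>
       braiding D i j * braiding D j i = 1)"


section \<open>The algebra R(D)\<close>

text \<open>The braided adjoint action, extended linearly from words to the free algebra.\<close>

definition ad_c :: "('g, 'k::field) datum \<Rightarrow> nat \<Rightarrow> 'k ncpoly \<Rightarrow> 'k ncpoly"
  where "ad_c D i f =
    (\<Sum>w\<in>Poly_Mapping.keys f. scalar (Poly_Mapping.lookup f w) *
       (xvar i * word_poly (letters w)
        - scalar (\<Prod>l\<leftarrow>letters w. braiding D i l) * word_poly (letters w) * xvar i))"

definition serre_relations :: "('g, 'k::field) datum \<Rightarrow> 'k ncpoly set"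
  where "serre_relations D =
    {(ad_c D i ^^ nat (1 - cartan_A i j)) (xvar j) | i j.
       i \<in> {1..datum_rank D} \<and> j \<in> {1..datum_rank D} \<and> i \<noteq> j}"

definition serre_ideal :: "('g, 'k::field) datum \<Rightarrow> 'k ncpoly set"
  where "serre_ideal D = Idl\<^bsub>free_algebra (datum_rank D)\<^esub> (serre_relations D)"

text \<open>The residue class in \<open>R(D)\<close> of an element of the free algebra.\<close>

definition cls :: "('g, 'k::field) datum \<Rightarrow> 'k ncpoly \<Rightarrow> 'k ncpoly set"
  where "cls D f = serre_ideal D +>\<^bsub>free_algebra (datum_rank D)\<^esub> f"

definition R_alg :: "('g, 'k::field) datum \<Rightarrow> ('k, 'k ncpoly set) module"
  where "R_alg D =
    (let Q = free_algebra (datum_rank D) Quot serre_ideal D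
     in ring.extend Q (module.fields (\<lambda>c a. cls D (scalar c) \<otimes>\<^bsub>Q\<^esub> a)))"

definition gen :: "('g, 'k::field) datum \<Rightarrow> nat \<Rightarrow> 'k ncpoly set"
  where "gen D i = cls D (xvar i)"


section \<open>Root vectors\<close>

text \<open>\<open>chr_prod D i j\<close> is \<open>\<chi>\<^sub>i\<^sub>j\<close>, the product of the characters \<open>\<chi>\<^sub>l\<close> with \<open>i \<le> l < j\<close>.\<close>

definition chr_prod :: "('g, 'k::field) datum \<Rightarrow> nat \<Rightarrow> nat \<Rightarrow> 'g \<Rightarrow> 'k"
  where "chr_prod D i j h = (\<Prod>l\<in>{i..<j}. datum_chr D l h)"

text \<open>
  For \<open>i < j\<close>, \<open>root_vector D i j\<close> is \<open>x\<^sub>i\<^sub>j\<close> and \<open>rev_root_vector D j i\<close> is the reverse root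
  vector \<open>x\<^sub>j\<^sub>i\<close>. The values at other arguments are irrelevant.
\<close>

function root_vector :: "('g, 'k::field) datum \<Rightarrow> nat \<Rightarrow> nat \<Rightarrow> 'k ncpoly set"
  where "root_vector D i j =
    (if j \<le> Suc i then gen D i
     else gen D i \<otimes>\<^bsub>R_alg D\<^esub> root_vector D (i + 1) j
       \<ominus>\<^bsub>R_alg D\<^esub> chr_prod D (i + 1) j (datum_elt D i) \<odot>\<^bsub>R_alg D\<^esub> (root_vector D (i + 1) j \<otimes>\<^bsub>R_alg D\<^esub> gen D i))"
  by pat_completeness auto
termination
  by (relation "measure (\<lambda>(D, i, j). j - i)") auto

declare root_vector.simps [simp del]

function rev_root_vector :: "('g, 'k::field) datum \<Rightarrow> nat \<Rightarrow> nat \<Rightarrow> 'k ncpoly set"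
  where "rev_root_vector D j i =
    (if j \<le> Suc i then gen D i
     else gen D (j - 1) \<otimes>\<^bsub>R_alg D\<^esub> rev_root_vector D (j - 1) i
       \<ominus>\<^bsub>R_alg D\<^esub> chr_prod D i (j - 1) (datum_elt D (j - 1)) \<odot>\<^bsub>R_alg D\<^esub>
           (rev_root_vector D (j - 1) i \<otimes>\<^bsub>R_alg D\<^esub> gen D (j - 1)))"
  by pat_completeness auto
termination
  by (relation "measure (\<lambda>(D, j, i). j - i)") auto

declare rev_root_vector.simps [simp del]


section \<open>The coefficients\<close>

text \<open>The set \<open>I\<^sub>i\<^sub>j\<close> of strictly increasing sequences from \<open>i\<close> to \<open>j\<close> of length at least 2.\<close>

definition index_seqs :: "nat \<Rightarrow> nat \<Rightarrow> nat list set"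
  where "index_seqs i j = {p. 2 \<le> length p \<and> hd p = i \<and> last p = j \<and> sorted_wrt (<) p}"

definition tau :: "('g, 'k::field) datum \<Rightarrow> nat \<Rightarrow> nat \<Rightarrow> nat \<Rightarrow> 'k"
  where "tau D N i j = (\<Prod>(k, l)\<in>{(k, l). i \<le> k \<and> k < l \<and> l < j}. braiding D l k ^ N)"

text \<open>For a list \<open>p = [i\<^sub>1, \<dots>, i\<^sub>r]\<close>, \<open>zip p (tl p)\<close> lists the pairs of consecutive entries.\<close>

definition tau_chain :: "('g, 'k::field) datum \<Rightarrow> nat \<Rightarrow> nat list \<Rightarrow> 'k"
  where "tau_chain D N p = (\<Prod>(a, b)\<leftarrow>zip p (tl p). tau D N a b)"

definition t_coeff ::
    "('g, 'k::field) datum \<Rightarrow> 'k \<Rightarrow> nat \<Rightarrow> nat \<Rightarrow> nat \<Rightarrow> nat list \<Rightarrow> 'k"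
  where "t_coeff D q N i j p =
    (-1) powi (int j - int i - int (length p) + 1)
    * (q - 1) ^ (N * (length p - 2))
    * tau_chain D N p powi (- int ((N - 1) div 2))
    * tau D N i j ^ ((N + 1) div 2)"

text \<open>The ordered product of the \<open>N\<close>-th powers of the root vectors along \<open>p\<close>.\<close>

definition root_power_chain :: "('g, 'k::field) datum \<Rightarrow> nat \<Rightarrow> nat list \<Rightarrow> 'k ncpoly set"
  where "root_power_chain D N p =
    foldr (\<lambda>(a, b) y. (root_vector D a b [^]\<^bsub>R_alg D\<^esub> N) \<otimes>\<^bsub>R_alg D\<^esub> y) (zip p (tl p)) \<one>\<^bsub>R_alg D\<^esub>"

end

theory Submission
  imports Defs
begin

text \<open>
  The heart of the matter is rank two. Let \<open>a\<close>, \<open>b\<close> satisfy the quantum Serre relations of type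
  \<open>A\<^sub>2\<close>, and let \<open>z = a b - c b a\<close> and \<open>y = b a - d a b\<close> with \<open>q c d = 1\<close>. Then \<open>y\<close> and \<open>z\<close> commute,
  both \<open>q\<close>-commute with \<open>a\<close>, and \<open>(q - 1) d a b = y + q d z\<close>. Hence \<open>a\<^sup>N b\<^sup>N\<close> is a multiple of
  \<open>\<Prod>\<^sub>k (y + q\<^sup>k d z) = y\<^sup>N + (d z)\<^sup>N\<close>, which expresses \<open>y\<^sup>N\<close> by \<open>a\<^sup>N b\<^sup>N\<close> and \<open>z\<^sup>N\<close>.

  This applies to \<open>a = x\<^sub>k\<^sub>i\<close> (reverse) and \<open>b = x\<^sub>k\<^sub>j\<close> for \<open>i < k < j\<close>: the rank two Serre relations
  pass from \<open>(y\<^sub>1, y\<^sub>2)\<close>, \<open>(y\<^sub>2, y\<^sub>3)\<close> to \<open>(y\<^sub>1, [y\<^sub>2, y\<^sub>3])\<close> when \<open>y\<^sub>1\<close> and \<open>y\<^sub>3\<close> \<open>q\<close>-commute. For \<open>k = j - 1\<close>,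
  \<open>y\<close> is the reverse root vector \<open>x\<^sub>j\<^sub>i\<close>, and in general \<open>z\<close> for \<open>k\<close> is proportional to \<open>y\<close> for
  \<open>k - 1\<close>. Iterating expresses \<open>x\<^sub>j\<^sub>i\<^sup>N\<close> by the products \<open>x\<^sub>k\<^sub>i\<^sup>N x\<^sub>k\<^sub>j\<^sup>N\<close>; induction on \<open>j\<close> gives the
  sum over all sequences, the last step of a sequence being the one from \<open>k\<close> to \<open>j\<close>.
\<close>

section \<open>Skew commutators and rank two Serre relations\<close>

text \<open>An associative algebra over the field \<open>'k\<close>. The scalars form a type instead
  of a carrier set, so that identities between coefficients are ordinary field arithmetic; the last
  two laws make them central.\<close>

locale scalar_ring = ring R for R :: "('k::field, 'a, 'm) module_scheme" (structure) +
  assumes smult_closed [simp, intro]: "x \<in> carrier R \<Longrightarrow> c \<odot> x \<in> carrier R"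
    and smult_add: "x \<in> carrier R \<Longrightarrow> y \<in> carrier R \<Longrightarrow> c \<odot> (x \<oplus> y) = c \<odot> x \<oplus> c \<odot> y"
    and add_smult: "x \<in> carrier R \<Longrightarrow> (c + d) \<odot> x = c \<odot> x \<oplus> d \<odot> x"
    and smult_smult: "x \<in> carrier R \<Longrightarrow> c \<odot> (d \<odot> x) = (c * d) \<odot> x"
    and one_smult: "x \<in> carrier R \<Longrightarrow> 1 \<odot> x = x"
    and smult_mult_left: "x \<in> carrier R \<Longrightarrow> y \<in> carrier R \<Longrightarrow> (c \<odot> x) \<otimes> y = c \<odot> (x \<otimes> y)"
    and smult_mult_right: "x \<in> carrier R \<Longrightarrow> y \<in> carrier R \<Longrightarrow> x \<otimes> (c \<odot> y) = c \<odot> (x \<otimes> y)"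
begin

lemma zero_smult: "x \<in> carrier R \<Longrightarrow> 0 \<odot> x = \<zero>"
  using add_smult[of x 0 0] by (metis add.r_cancel_one add_0 smult_closed)

lemma smult_zero: "c \<odot> \<zero> = \<zero>"
  using smult_add[of \<zero> \<zero> c] by (metis add.r_cancel_one r_zero smult_closed zero_closed)

lemma neg_smult: "x \<in> carrier R \<Longrightarrow> (- c) \<odot> x = \<ominus> (c \<odot> x)"
  using add_smult[of x c "- c"]
  by (intro minus_equality[symmetric]) (simp_all add: zero_smult a_comm)

lemma smult_neg: "x \<in> carrier R \<Longrightarrow> c \<odot> (\<ominus> x) = \<ominus> (c \<odot> x)"
  using smult_add[of x "\<ominus> x" c]
  by (intro minus_equality[symmetric]) (simp_all add: smult_zero r_neg a_comm)

lemma smult_cancel: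
  "c \<noteq> 0 \<Longrightarrow> x \<in> carrier R \<Longrightarrow> y \<in> carrier R \<Longrightarrow> c \<odot> x = c \<odot> y \<longleftrightarrow> x = y"
  by (metis left_inverse one_smult smult_smult)

lemmas scalar_simps = smult_add smult_smult one_smult smult_mult_left smult_mult_right smult_neg
  l_distr r_distr l_minus r_minus minus_add minus_eq m_assoc

lemma eq_minus_rearrange:
  assumes "a \<in> carrier R" "b \<in> carrier R" "c \<in> carrier R" "d \<in> carrier R"
  shows "a \<ominus> b = c \<ominus> d \<longleftrightarrow> a \<oplus> d = c \<oplus> b"
proof -
  have "a \<ominus> b = c \<ominus> d \<longleftrightarrow> a = (c \<oplus> b) \<ominus> d"
    using assms add.inv_solve_right'[of "c \<ominus> d" a b] by (auto simp: minus_eq a_ac)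
  also have "\<dots> \<longleftrightarrow> a \<oplus> d = c \<oplus> b"
    using assms add.inv_solve_right[of a "c \<oplus> b" d] by (auto simp: minus_eq)
  finally show ?thesis .
qed

text \<open>The braided commutator. Its factor is a parameter because the bare algebra has no
  grading from which the braiding of \<open>x\<close> and \<open>y\<close> could be read
  off.\<close>

definition br :: "'k \<Rightarrow> 'a \<Rightarrow> 'a \<Rightarrow> 'a"
  where "br c x y = x \<otimes> y \<ominus> c \<odot> (y \<otimes> x)"

lemma br_closed [simp, intro]: "x \<in> carrier R \<Longrightarrow> y \<in> carrier R \<Longrightarrow> br c x y \<in> carrier R"
  by (simp add: br_def)

lemma mult_eq_br:
  "x \<in> carrier R \<Longrightarrow> y \<in> carrier R \<Longrightarrow> x \<otimes> y = br c x y \<oplus> c \<odot> (y \<otimes> x)"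
  by (simp add: br_def minus_eq a_assoc l_neg)

definition qcomm :: "'k \<Rightarrow> 'a \<Rightarrow> 'a \<Rightarrow> bool"
  where "qcomm c x y \<longleftrightarrow> x \<otimes> y = c \<odot> (y \<otimes> x)"

lemma qcomm_left:
  assumes "qcomm c x y" "x \<in> carrier R" "y \<in> carrier R" "z \<in> carrier R"
  shows "x \<otimes> (y \<otimes> z) = c \<odot> (y \<otimes> (x \<otimes> z))"
  using assms by (metis m_assoc m_closed qcomm_def smult_mult_left)

lemma qcomm_sym:
  assumes "qcomm c x y" "c * d = 1" "x \<in> carrier R" "y \<in> carrier R"
  shows "qcomm d y x"
  using assms by (simp add: qcomm_def smult_smult mult.commute one_smult)

text \<open>Moving \<open>x\<close> past \<open>y z\<close> and past \<open>z y\<close> costs the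
  same factor \<open>c * d\<close>.\<close>

lemma qcomm_br:
  assumes "qcomm c x y" "qcomm d x z" "x \<in> carrier R" "y \<in> carrier R" "z \<in> carrier R"
  shows "qcomm (c * d) x (br e y z)"
  unfolding qcomm_def br_def using assms
  by (simp add: scalar_simps qcomm_left[OF assms(1)] qcomm_left[OF assms(2)]
      assms(1)[unfolded qcomm_def] assms(2)[unfolded qcomm_def] mult_ac)

lemma qcomm_br_left:
  assumes "qcomm c y x" "qcomm d z x" "c \<noteq> 0" "d \<noteq> 0"
    "x \<in> carrier R" "y \<in> carrier R" "z \<in> carrier R"
  shows "qcomm (c * d) (br e y z) x"
proof -
  have "qcomm (inverse c * inverse d) x (br e y z)"
    using assms by (intro qcomm_br) (auto intro: qcomm_sym)
  then show ?thesis
    by (rule qcomm_sym) (use assms in \<open>auto simp: field_simps\<close>)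
qed

text \<open>A braided Jacobi identity without a term in \<open>[x, z]\<close>: once
  \<open>x z\<close> is replaced by \<open>d z x\<close>, both sides are the same combination of
  \<open>x y z\<close>, \<open>z x y\<close>, \<open>y z x\<close> and \<open>z y x\<close>.\<close>

lemma br_br:
  assumes "qcomm d x z" "x \<in> carrier R" "y \<in> carrier R" "z \<in> carrier R"
  shows "br (c * d) x (br e y z) = br (d * e) (br c x y) z"
  unfolding br_def using assms(2-)
  by (simp add: scalar_simps qcomm_left[OF assms(1)] assms(1)[unfolded qcomm_def] a_ac mult_ac)

text \<open>Commutators with \<open>x\<close> and with \<open>z\<close> can be taken in either
  order, since \<open>x\<close> and \<open>z\<close> skew-commute. This is what makes
  \<open>br_eq_mixed\<close> work.\<close>

lemma br_br_swap:
  assumes "qcomm d x z" "x \<in> carrier R" "y \<in> carrier R" "z \<in> carrier R"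
  shows "br (c * d) (br (d * e) y x) z = d \<odot> br e (br c y z) x"
  unfolding br_def using assms(2-)
  by (simp add: scalar_simps qcomm_left[OF assms(1)] assms(1)[unfolded qcomm_def] a_ac mult_ac)

text \<open>As \<open>ad\<^sub>c(a)(b) = br c a b\<close>, the first conjunct is the quantum Serre relation
  \<open>ad\<^sub>c(a)\<^sup>2(b) = 0\<close>. By \<open>qcomm_br_iff\<close> below, the second one is \<open>ad\<^sub>c(b)\<^sup>2(a) = 0\<close>.\<close>

definition serre2 :: "'k \<Rightarrow> 'k \<Rightarrow> 'a \<Rightarrow> 'a \<Rightarrow> bool"
  where "serre2 q c a b \<longleftrightarrow> qcomm (q * c) a (br c a b) \<and> qcomm (q * c) (br c a b) b"

text \<open>Both sides are one linear relation between \<open>a b b\<close>, \<open>b a b\<close>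
  and \<open>b b a\<close>: as \<open>q c d = 1\<close>, the left one multiplied by
  \<open>q d^2\<close> is the right one up to moving terms across.\<close>

lemma qcomm_br_iff:
  assumes "a \<in> carrier R" "b \<in> carrier R" "q * c * d = 1"
  shows "qcomm (q * c) (br c a b) b \<longleftrightarrow> qcomm (q * d) b (br d b a)"
proof -
  let ?X = "(q * d * d) \<odot> (a \<otimes> (b \<otimes> b))" and ?P = "b \<otimes> (a \<otimes> b)" and ?Q = "b \<otimes> (b \<otimes> a)"
  have c: "q * d * d * c = d" "q * d * d * (q * c) = q * d" "q * d * d * (q * c * c) = 1"
  proof -
    have "q * d * d * c = (q * c * d) * d" "q * d * d * (q * c) = (q * c * d) * (q * d)"
      "q * d * d * (q * c * c) = (q * c * d) * (q * c * d)"
      by (simp_all only: mult_ac)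
    then show "q * d * d * c = d" "q * d * d * (q * c) = q * d" "q * d * d * (q * c * c) = 1"
      by (simp_all add: assms(3))
  qed
  have "qcomm (q * c) (br c a b) b \<longleftrightarrow>
      (q * d * d) \<odot> (br c a b \<otimes> b) = (q * d * d) \<odot> ((q * c) \<odot> (b \<otimes> br c a b))"
    unfolding qcomm_def by (subst smult_cancel) (use assms in auto)
  also have "(q * d * d) \<odot> (br c a b \<otimes> b) = ?X \<ominus> d \<odot> ?P"
    using assms(1,2) by (simp add: br_def scalar_simps) (simp only: c(1))
  also have "(q * d * d) \<odot> ((q * c) \<odot> (b \<otimes> br c a b)) = (q * d) \<odot> ?P \<ominus> ?Q"
    using assms(1,2) by (simp add: br_def scalar_simps) (simp only: c one_smult m_closed)
  also have "?X \<ominus> d \<odot> ?P = (q * d) \<odot> ?P \<ominus> ?Q \<longleftrightarrow> ?Q \<ominus> d \<odot> ?P = (q * d) \<odot> ?P \<ominus> ?X"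
    using assms(1,2) by (simp add: eq_minus_rearrange a_comm[of ?X])
  also have "?Q \<ominus> d \<odot> ?P = b \<otimes> br d b a"
    using assms(1,2) by (simp add: br_def scalar_simps)
  also have "(q * d) \<odot> ?P \<ominus> ?X = (q * d) \<odot> (br d b a \<otimes> b)"
    using assms(1,2) by (simp add: br_def scalar_simps mult.assoc)
  finally show ?thesis
    by (simp add: qcomm_def)
qed

lemma serre2_sym:
  assumes "serre2 q c a b" "a \<in> carrier R" "b \<in> carrier R" "q * c * d = 1"
  shows "serre2 q d b a"
  using assms qcomm_br_iff[of a b q c d] qcomm_br_iff[of b a q d c]
  by (auto simp: serre2_def mult_ac)

text \<open>With \<open>u = br c12 y1 y2\<close>, \<open>v = br c23 y2 y3\<close> and \<open>s = br _ y1 v = br _ u y3\<close>, each of the two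
  expressions for \<open>s\<close> expands \<open>s y2\<close> into a multiple of \<open>y2 s\<close> plus a multiple of one and the same
  error term \<open>T\<close>; it is eliminated using \<open>1 + q \<noteq> 0\<close>.\<close>

lemma serre2_middle:
  assumes s12: "serre2 q c12 y1 y2" and s23: "serre2 q c23 y2 y3" and q13: "qcomm c13 y1 y3"
    and nz: "1 + q \<noteq> 0" "c23 \<noteq> 0"
    and [simp]: "y1 \<in> carrier R" "y2 \<in> carrier R" "y3 \<in> carrier R"
  shows "qcomm (c12 / c23) (br (c12 * c13) y1 (br c23 y2 y3)) y2"
proof -
  define u v where "u = br c12 y1 y2" and "v = br c23 y2 y3"
  define s where "s = br (c12 * c13) y1 v"
  define T where "T = u \<otimes> v \<ominus> (q * c12 * c13 * c23) \<odot> (v \<otimes> u)"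
  have [simp]: "u \<in> carrier R" "v \<in> carrier R" "s \<in> carrier R" "T \<in> carrier R"
    by (simp_all add: u_def v_def s_def T_def)
  have s': "s = br (c13 * c23) u y3"
    unfolding s_def u_def v_def by (rule br_br) (use q13 in auto)
  have y12: "y1 \<otimes> y2 = u \<oplus> c12 \<odot> (y2 \<otimes> y1)"
    unfolding u_def by (rule mult_eq_br) auto
  have y32: "c23 \<odot> (y3 \<otimes> y2) = y2 \<otimes> y3 \<ominus> v"
    by (simp add: v_def br_def scalar_simps r_neg2 l_neg a_ac)
  have y2v: "y2 \<otimes> v = (q * c23) \<odot> (v \<otimes> y2)" and uy2: "u \<otimes> y2 = (q * c12) \<odot> (y2 \<otimes> u)"
    using s12 s23 by (simp_all add: serre2_def qcomm_def u_def v_def)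
  have E1: "(q * c23) \<odot> (s \<otimes> y2) = c12 \<odot> (y2 \<otimes> s) \<oplus> T"
  proof -
    have "(q * c23) \<odot> (s \<otimes> y2) = y1 \<otimes> ((q * c23) \<odot> (v \<otimes> y2)) \<ominus> (q * c12 * c13 * c23) \<odot> (v \<otimes> (y1 \<otimes> y2))"
      by (simp add: s_def br_def scalar_simps mult_ac)
    also have "\<dots> = (y1 \<otimes> y2) \<otimes> v \<ominus> (q * c12 * c13 * c23) \<odot> (v \<otimes> (y1 \<otimes> y2))"
      by (simp add: m_assoc flip: y2v)
    also have "\<dots> = (u \<oplus> c12 \<odot> (y2 \<otimes> y1)) \<otimes> v \<ominus>
        ((q * c12 * c13 * c23) \<odot> (v \<otimes> u) \<oplus> (c12 * c12 * c13) \<odot> (((q * c23) \<odot> (v \<otimes> y2)) \<otimes> y1))"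
      by (simp add: y12 scalar_simps mult_ac)
    also have "\<dots> = (u \<oplus> c12 \<odot> (y2 \<otimes> y1)) \<otimes> v \<ominus>
        ((q * c12 * c13 * c23) \<odot> (v \<otimes> u) \<oplus> (c12 * c12 * c13) \<odot> ((y2 \<otimes> v) \<otimes> y1))"
      by (simp flip: y2v)
    also have "\<dots> = c12 \<odot> (y2 \<otimes> s) \<oplus> T"
      by (simp add: s_def br_def T_def scalar_simps a_ac mult_ac)
    finally show ?thesis .
  qed
  have E2: "c23 \<odot> (s \<otimes> y2) = (q * c12) \<odot> (y2 \<otimes> s) \<ominus> T"
  proof -
    have "c23 \<odot> (s \<otimes> y2) = u \<otimes> (c23 \<odot> (y3 \<otimes> y2)) \<ominus> (c13 * c23 * c23) \<odot> (y3 \<otimes> (u \<otimes> y2))"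
      by (simp add: s' br_def scalar_simps mult_ac)
    also have "\<dots> = u \<otimes> (y2 \<otimes> y3 \<ominus> v) \<ominus> (q * c12 * c13 * c23) \<odot> ((c23 \<odot> (y3 \<otimes> y2)) \<otimes> u)"
      by (subst y32[symmetric]) (simp add: uy2 scalar_simps mult_ac)
    also have "\<dots> = (u \<otimes> y2) \<otimes> y3 \<ominus> u \<otimes> v \<ominus> (q * c12 * c13 * c23) \<odot> ((y2 \<otimes> y3 \<ominus> v) \<otimes> u)"
      unfolding y32 by (simp add: scalar_simps a_ac)
    also have "\<dots> = (q * c12) \<odot> (y2 \<otimes> s) \<ominus> T"
      unfolding uy2 by (simp add: s' br_def T_def scalar_simps a_ac mult_ac)
    finally show ?thesis .
  qed
  have "((1 + q) * c23) \<odot> (s \<otimes> y2) = c23 \<odot> (s \<otimes> y2) \<oplus> (q * c23) \<odot> (s \<otimes> y2)"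
    by (simp add: ring_distribs add_smult)
  also have "\<dots> = (q * c12) \<odot> (y2 \<otimes> s) \<oplus> c12 \<odot> (y2 \<otimes> s)"
    unfolding E1 E2 by (simp add: minus_eq a_ac r_neg2 r_neg1)
  also have "\<dots> = ((1 + q) * c23) \<odot> ((c12 / c23) \<odot> (y2 \<otimes> s))"
  proof -
    have "(1 + q) * c23 * (c12 / c23) = q * c12 + c12"
      using nz by (simp add: field_simps)
    then show ?thesis
      by (simp add: add_smult smult_smult)
  qed
  finally have "s \<otimes> y2 = (c12 / c23) \<odot> (y2 \<otimes> s)"
    using nz by (subst (asm) smult_cancel) auto
  then show ?thesis
    by (simp add: qcomm_def s_def v_def)
qed

text \<open>Let \<open>v\<close> be the commutator of \<open>y2\<close> and \<open>y3\<close>, and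
  \<open>s\<close> that of \<open>y1\<close> and \<open>v\<close>. By \<open>br_br\<close>,
  \<open>s\<close> is also a commutator of \<open>br c12 y1 y2\<close> and \<open>y3\<close>, and
  \<open>y1\<close> skew-commutes with both of these. Conversely \<open>s\<close> skew-commutes with
  \<open>y2\<close> by \<open>serre2_middle\<close> and with \<open>y3\<close> because
  \<open>y1\<close> and \<open>v\<close> do, hence with \<open>v\<close>.\<close>

lemma serre2_br:
  assumes s12: "serre2 q c12 y1 y2" and s23: "serre2 q c23 y2 y3" and q13: "qcomm c13 y1 y3"
    and nz: "1 + q \<noteq> 0" "q \<noteq> 0" "c12 \<noteq> 0" "c13 \<noteq> 0" "c23 \<noteq> 0"
    and [simp]: "y1 \<in> carrier R" "y2 \<in> carrier R" "y3 \<in> carrier R"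
  shows "serre2 q (c12 * c13) y1 (br c23 y2 y3)"
proof -
  define s where "s = br (c12 * c13) y1 (br c23 y2 y3)"
  have [simp]: "s \<in> carrier R"
    by (simp add: s_def)
  have "s = br (c13 * c23) (br c12 y1 y2) y3"
    unfolding s_def by (rule br_br) (use q13 in auto)
  then have "qcomm (q * c12 * c13) y1 s"
    using s12 q13 by (simp add: serre2_def qcomm_br)
  moreover have "qcomm (c12 / c23) s y2"
    unfolding s_def by (rule serre2_middle[OF s12 s23 q13 nz(1,5)]) auto
  moreover have "qcomm (c13 * (q * c23)) s y3"
    unfolding s_def by (rule qcomm_br_left) (use s23 q13 nz in \<open>auto simp: serre2_def\<close>)
  ultimately have "qcomm (q * c12 * c13) y1 s" "qcomm (c12 / c23 * (c13 * (q * c23))) s (br c23 y2 y3)"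
    by (simp, intro qcomm_br) auto
  then show ?thesis
    using nz by (simp add: serre2_def s_def mult_ac)
qed

end

section \<open>Powers in rank two\<close>

text \<open>Both sides are monic of degree \<open>N\<close> and vanish at the \<open>N\<close>
  distinct points \<open>- (q ^ Suc k)\<close>; for the right side this uses that \<open>N\<close>
  is odd.\<close>

lemma prod_linear_roots_of_unity:
  fixes q :: "'k::field"
  assumes q: "root_of_unity_of_order q N" and "odd N"
  shows "(\<Prod>k<N. [:q ^ Suc k, 1:]) = monom 1 N + 1"
proof (rule poly_eqI_degree_lead_coeff[where n = N and A = "(\<lambda>k. - (q ^ Suc k)) ` {..<N}"])
  have N: "0 < N" and q1: "q ^ N = 1" and ord: "\<And>m. 0 < m \<Longrightarrow> m < N \<Longrightarrow> q ^ m \<noteq> 1"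
    using q by (auto simp: root_of_unity_of_order_def)
  have "q \<noteq> 0"
    using N q1 by (auto simp: zero_power)
  have "i = j" if "q ^ Suc i = q ^ Suc j" "i \<le> j" "j < N" for i j
  proof (rule ccontr)
    assume "i \<noteq> j"
    have "Suc j = Suc i + (j - i)"
      using that by simp
    then have "q ^ Suc i * q ^ (j - i) = q ^ Suc i"
      using that(1) by (metis power_add)
    then have "q ^ (j - i) = 1"
      using \<open>q \<noteq> 0\<close> by simp
    then show False
      using ord[of "j - i"] that \<open>i \<noteq> j\<close> by auto
  qed
  then have "inj_on (\<lambda>k. - (q ^ Suc k)) {..<N}"
    by (intro inj_onI) (metis lessThan_iff linorder_le_cases neg_equal_iff_equal)
  then show "N \<le> card ((\<lambda>k. - (q ^ Suc k)) ` {..<N})"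
    by (simp add: card_image)
  have deg: "degree (\<Prod>k<N. [:q ^ Suc k, 1:]) = N"
    by (subst degree_prod_eq_sum_degree) auto
  have "lead_coeff (\<Prod>k<N. [:q ^ Suc k, 1:]) = 1"
    by (simp add: lead_coeff_prod)
  then show "coeff (\<Prod>k<N. [:q ^ Suc k, 1:]) N = coeff (monom 1 N + 1) N"
    using deg N by simp
  show "degree (\<Prod>k<N. [:q ^ Suc k, 1:]) \<le> N"
    using deg by simp
  show "degree (monom 1 N + 1 :: 'k poly) \<le> N"
    by (intro degree_add_le) (auto simp: degree_monom_le)
  fix x assume "x \<in> (\<lambda>k. - (q ^ Suc k)) ` {..<N}"
  then obtain k where k: "k < N" "x = - (q ^ Suc k)"
    by auto
  have "(q ^ Suc k) ^ N = 1"
    using q1 by (metis power_mult mult.commute power_one)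
  then have "x ^ N = - 1"
    using k \<open>odd N\<close> by (simp add: power_minus_odd)
  moreover have "poly (\<Prod>k<N. [:q ^ Suc k, 1:]) x = 0"
    using k by (auto simp: poly_prod)
  ultimately show "poly (\<Prod>k<N. [:q ^ Suc k, 1:]) x = poly (monom 1 N + 1) x"
    by (simp add: poly_monom)
qed

section \<open>Homogenized polynomials in two commuting elements\<close>

context scalar_ring
begin

lemma smult_finsum:
  assumes "f \<in> A \<rightarrow> carrier R"
  shows "c \<odot> finsum R f A = (\<Oplus>i\<in>A. c \<odot> f i)"
  using assms
proof (induction A rule: infinite_finite_induct)
  case (insert x F)
  then have "f \<in> F \<rightarrow> carrier R" "f x \<in> carrier R" "(\<lambda>i. c \<odot> f i) \<in> F \<rightarrow> carrier R"
    by auto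
  then show ?case
    using insert by (simp add: smult_add)
qed (simp_all add: smult_zero)

lemma pow_left_commute:
  assumes "y \<otimes> z = z \<otimes> y" "y \<in> carrier R" "z \<in> carrier R" "w \<in> carrier R"
  shows "z \<otimes> (y [^] (l::nat) \<otimes> w) = y [^] l \<otimes> (z \<otimes> w)"
  using assms by (metis m_assoc nat_pow_closed group_commutes_pow)

lemma pow_mult_comm: "z \<in> carrier R \<Longrightarrow> z \<otimes> z [^] (l::nat) = z [^] l \<otimes> z"
  by (metis nat_pow_Suc nat_pow_Suc2)

text \<open>The degree \<open>m\<close> homogenization of \<open>p\<close>, evaluated at \<open>(y, z)\<close>.\<close>

definition hom_eval :: "nat \<Rightarrow> 'k poly \<Rightarrow> 'a \<Rightarrow> 'a \<Rightarrow> 'a"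
  where "hom_eval m p y z = (\<Oplus>l\<in>{..m}. coeff p l \<odot> (y [^] l \<otimes> z [^] (m - l)))"

context
  fixes y z
  assumes y [simp]: "y \<in> carrier R" and z [simp]: "z \<in> carrier R"
begin

lemma hom_eval_closed [simp]: "hom_eval m p y z \<in> carrier R"
  by (auto simp: hom_eval_def)

lemma hom_eval_add: "hom_eval m (p + r) y z = hom_eval m p y z \<oplus> hom_eval m r y z"
  unfolding hom_eval_def by (subst finsum_addf[symmetric]) (auto simp: add_smult)

lemma hom_eval_smult: "hom_eval m (Polynomial.smult c p) y z = c \<odot> hom_eval m p y z"
  unfolding hom_eval_def by (subst smult_finsum) (auto simp: smult_smult)

lemma hom_eval_monom:
  assumes "k \<le> m"
  shows "hom_eval m (monom c k) y z = c \<odot> (y [^] k \<otimes> z [^] (m - k))"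
proof -
  have "hom_eval m (monom c k) y z = (\<Oplus>l\<in>{..m}. if k = l then c \<odot> (y [^] l \<otimes> z [^] (m - l)) else \<zero>)"
    unfolding hom_eval_def by (rule finsum_cong') (auto simp: zero_smult)
  also have "\<dots> = c \<odot> (y [^] k \<otimes> z [^] (m - k))"
    using assms by (subst finsum_singleton) auto
  finally show ?thesis .
qed

lemma hom_eval_1: "hom_eval m 1 y z = z [^] m"
  using hom_eval_monom[of 0 m 1] by (simp add: one_smult)

lemma hom_eval_pCons_0: "hom_eval (Suc m) (pCons 0 p) y z = y \<otimes> hom_eval m p y z"
proof -
  have "hom_eval (Suc m) (pCons 0 p) y z = (\<Oplus>l\<in>{..m}. coeff p l \<odot> (y \<otimes> (y [^] l \<otimes> z [^] (m - l))))"
    unfolding hom_eval_def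
    by (subst finsum_Suc2) (auto simp: zero_smult m_assoc pow_left_commute[OF refl])
  also have "\<dots> = y \<otimes> hom_eval m p y z"
    unfolding hom_eval_def by (subst finsum_rdistr) (auto simp: smult_mult_right)
  finally show ?thesis .
qed

text \<open>Every term gains a factor \<open>z\<close>; the new top term in \<open>y^(m+1)\<close>
  vanishes by the degree bound.\<close>

lemma hom_eval_Suc:
  assumes "y \<otimes> z = z \<otimes> y" and p: "degree p \<le> m"
  shows "hom_eval (Suc m) p y z = z \<otimes> hom_eval m p y z"
proof -
  have "hom_eval (Suc m) p y z = (\<Oplus>l\<in>{..m}. coeff p l \<odot> (y [^] l \<otimes> z [^] (Suc m - l)))"
    unfolding hom_eval_def using p
    by (subst finsum_Suc) (auto simp: coeff_eq_0 zero_smult simp del: nat_pow_Suc)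
  also have "\<dots> = (\<Oplus>l\<in>{..m}. z \<otimes> (coeff p l \<odot> (y [^] l \<otimes> z [^] (m - l))))"
    by (rule finsum_cong')
      (auto simp: smult_mult_right pow_left_commute[OF assms(1)] Suc_diff_le pow_mult_comm)
  also have "\<dots> = z \<otimes> hom_eval m p y z"
    unfolding hom_eval_def by (subst finsum_rdistr) auto
  finally show ?thesis .
qed

text \<open>The product is \<open>c p\<close> plus a shift of \<open>p\<close>. To reach degree
  \<open>m + 1\<close>, the first summand gains a factor \<open>z\<close> and the second a factor
  \<open>y\<close>.\<close>

lemma hom_eval_mult_linear:
  assumes "y \<otimes> z = z \<otimes> y" and "degree p \<le> m"
  shows "hom_eval (Suc m) ([:c, 1:] * p) y z = (y \<oplus> c \<odot> z) \<otimes> hom_eval m p y z"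
proof -
  have "[:c, 1:] * p = Polynomial.smult c p + pCons 0 p"
    by simp
  then show ?thesis
    using assms
    by (simp only: hom_eval_add hom_eval_smult hom_eval_pCons_0 hom_eval_Suc)
      (simp add: l_distr smult_mult_left a_comm)
qed

end

section \<open>The power formula for a Serre pair\<close>

lemma qcomm_pow:
  assumes "qcomm c a y" "a \<in> carrier R" "y \<in> carrier R"
  shows "qcomm (c ^ m) (a [^] m) y"
proof (induction m)
  case (Suc m)
  have "a [^] Suc m \<otimes> y = c \<odot> ((a [^] m \<otimes> y) \<otimes> a)"
    using assms by (simp add: qcomm_def m_assoc smult_mult_right)
  also have "\<dots> = c ^ Suc m \<odot> (y \<otimes> a [^] Suc m)"
    using Suc assms by (simp add: qcomm_def m_assoc smult_mult_left smult_smult)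
  finally show ?case
    by (simp add: qcomm_def)
qed (use assms in \<open>simp add: qcomm_def one_smult\<close>)

text \<open>That \<open>a\<close> and \<open>y\<close> skew-commute is the Serre relation with
  \<open>a\<close> and \<open>b\<close> exchanged. Since \<open>a z = q c z a\<close> and
  \<open>z b = q c b z\<close>, the element \<open>z\<close> commutes with \<open>a b\<close>, and
  \<open>y\<close> is a multiple of \<open>a b\<close> plus a multiple of \<open>z\<close>.\<close>

lemma serre2_br_rev:
  assumes S: "serre2 q c a b" and qcd: "q * c * d = 1"
    and [simp]: "a \<in> carrier R" "b \<in> carrier R"
  defines "z \<equiv> br c a b" and "y \<equiv> br d b a"
  shows "((q - 1) * d) \<odot> (a \<otimes> b) = y \<oplus> (q * d) \<odot> z"
    and "qcomm c a y" and "y \<otimes> z = z \<otimes> y"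
proof -
  have [simp]: "z \<in> carrier R" "y \<in> carrier R"
    by (simp_all add: z_def y_def)
  have nz: "q \<noteq> 0" "c \<noteq> 0" "d \<noteq> 0"
    using qcd by auto
  have az: "a \<otimes> z = (q * c) \<odot> (z \<otimes> a)" and zb: "z \<otimes> b = (q * c) \<odot> (b \<otimes> z)"
    using S by (simp_all add: serre2_def qcomm_def z_def)
  \<comment> \<open>As \<open>q d c = 1\<close>, the term \<open>b a\<close> here cancels the one in
    \<open>y\<close>.\<close>
  have "(q * d) \<odot> z = (q * d) \<odot> (a \<otimes> b) \<ominus> b \<otimes> a"
    using qcd by (simp add: z_def br_def scalar_simps mult_ac)
  then have sum: "y \<oplus> (q * d) \<odot> z = (q * d) \<odot> (a \<otimes> b) \<ominus> d \<odot> (a \<otimes> b)"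
    by (simp add: y_def br_def minus_eq a_ac r_neg1 r_neg2 l_neg r_neg)
  then show sum': "((q - 1) * d) \<odot> (a \<otimes> b) = y \<oplus> (q * d) \<odot> z"
    by (simp add: left_diff_distrib minus_eq flip: neg_smult add_smult)
  have "qcomm (q * d) y a"
    using serre2_sym[OF S] qcd by (simp add: serre2_def y_def)
  then show "qcomm c a y"
    by (rule qcomm_sym) (use qcd in \<open>simp_all add: mult_ac\<close>)
  have "(q * c) \<odot> ((a \<otimes> b) \<otimes> z) = (q * c) \<odot> (z \<otimes> (a \<otimes> b))"
  proof -
    have "(q * c) \<odot> ((a \<otimes> b) \<otimes> z) = a \<otimes> (z \<otimes> b)"
      by (simp add: zb smult_mult_right m_assoc)
    also have "\<dots> = (q * c) \<odot> (z \<otimes> (a \<otimes> b))"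
      by (simp add: az smult_mult_left flip: m_assoc)
    finally show ?thesis .
  qed
  then have "(a \<otimes> b) \<otimes> z = z \<otimes> (a \<otimes> b)"
    using nz by (subst (asm) smult_cancel) auto
  then have "(y \<oplus> (q * d) \<odot> z) \<otimes> z = z \<otimes> (y \<oplus> (q * d) \<odot> z)"
    by (simp add: smult_mult_left smult_mult_right flip: sum')
  then show "y \<otimes> z = z \<otimes> y"
    by (simp add: l_distr r_distr smult_mult_left smult_mult_right)
qed

text \<open>Commuting \<open>a\<^sup>m\<close> past \<open>(q - 1) d a b = y + q d z\<close> multiplies \<open>y\<close> by \<open>c\<^sup>m\<close> and \<open>z\<close> by \<open>(q c)\<^sup>m\<close>.\<close>

lemma serre2_pow_mult_pow:
  assumes S: "serre2 q c a b" and qcd: "q * c * d = 1"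
    and [simp]: "a \<in> carrier R" "b \<in> carrier R"
  shows "((q - 1) * d) ^ m \<odot> (a [^] m \<otimes> b [^] m) =
    (\<Prod>k<m. c ^ k) \<odot> hom_eval m (\<Prod>k<m. [:q ^ Suc k, 1:]) (br d b a) (d \<odot> br c a b)"
proof (induction m)
  case 0
  show ?case
    by (simp add: hom_eval_def one_smult)
next
  case (Suc m)
  define z y where "z = br c a b" and "y = br d b a"
  define e where "e = (q - 1) * d"
  let ?p = "\<Prod>k<m. [:q ^ Suc k, 1:]"
  have [simp]: "z \<in> carrier R" "y \<in> carrier R"
    by (simp_all add: z_def y_def)
  note rev = serre2_br_rev[OF S qcd, folded z_def y_def e_def, simplified]
  have ay: "a [^] m \<otimes> y = c ^ m \<odot> (y \<otimes> a [^] m)"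
    using qcomm_pow[OF rev(2)] by (simp add: qcomm_def)
  have az: "a [^] m \<otimes> z = (q * c) ^ m \<odot> (z \<otimes> a [^] m)"
    using qcomm_pow[of "q * c" a z m] S by (simp add: qcomm_def serre2_def z_def)
  \<comment> \<open>One factor \<open>a b\<close> is isolated in the middle of
    \<open>a^m (a b) b^m\<close>, where the identity for \<open>(q - 1) d a b\<close>
    applies.\<close>
  have "e ^ Suc m \<odot> (a [^] Suc m \<otimes> b [^] Suc m) = a [^] m \<otimes> (e \<odot> (a \<otimes> b)) \<otimes> (e ^ m \<odot> b [^] m)"
    unfolding nat_pow_Suc2[OF \<open>b \<in> carrier R\<close>]
    by (simp add: smult_mult_left smult_mult_right smult_smult m_assoc mult_ac)
  also have "a [^] m \<otimes> (e \<odot> (a \<otimes> b)) = c ^ m \<odot> ((y \<oplus> q ^ Suc m \<odot> (d \<odot> z)) \<otimes> a [^] m)"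
    by (simp add: rev ay az scalar_simps mult_ac power_mult_distrib)
  also have "\<dots> \<otimes> (e ^ m \<odot> b [^] m) =
      c ^ m \<odot> ((y \<oplus> q ^ Suc m \<odot> (d \<odot> z)) \<otimes> (e ^ m \<odot> (a [^] m \<otimes> b [^] m)))"
    by (simp add: smult_mult_left smult_mult_right smult_smult m_assoc mult_ac)
  also have "\<dots> = (\<Prod>k<Suc m. c ^ k) \<odot> ((y \<oplus> q ^ Suc m \<odot> (d \<odot> z)) \<otimes> hom_eval m ?p y (d \<odot> z))"
    unfolding Suc.IH[folded e_def y_def z_def]
    by (simp add: smult_mult_right smult_smult mult_ac del: power_Suc)
  also have "(y \<oplus> q ^ Suc m \<odot> (d \<odot> z)) \<otimes> hom_eval m ?p y (d \<odot> z) =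
      hom_eval (Suc m) ([:q ^ Suc m, 1:] * ?p) y (d \<odot> z)"
  proof (rule hom_eval_mult_linear[symmetric])
    show "y \<otimes> (d \<odot> z) = d \<odot> z \<otimes> y"
      using rev by (simp add: smult_mult_left smult_mult_right)
    have "degree ?p \<le> (\<Sum>k<m. degree [:q ^ Suc k, 1:])"
      using degree_prod_sum_le[of "{..<m}" "\<lambda>k. [:q ^ Suc k, 1:]"] by (simp add: o_def)
    then show "degree ?p \<le> m"
      by simp
  qed auto
  also have "[:q ^ Suc m, 1:] * ?p = (\<Prod>k<Suc m. [:q ^ Suc k, 1:])"
    by (simp add: mult.commute del: power_Suc)
  finally show ?case
    by (simp only: e_def y_def z_def)
qed

lemma smult_pow: "x \<in> carrier R \<Longrightarrow> (c \<odot> x) [^] (m::nat) = c ^ m \<odot> (x [^] m)"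
  by (induction m) (simp_all add: one_smult smult_mult_left smult_mult_right smult_smult mult.commute)

text \<open>For \<open>m = N\<close> the product of the linear factors is \<open>T^N + 1\<close>, so
  the homogenization is \<open>y^N + (d z)^N\<close>.\<close>

lemma serre2_br_pow:
  assumes S: "serre2 q c a b" and qcd: "q * c * d = 1"
    and q: "root_of_unity_of_order q N" "odd N"
    and [simp]: "a \<in> carrier R" "b \<in> carrier R"
  shows "br d b a [^] N =
    ((q - 1) ^ N * d ^ (N * ((N + 1) div 2))) \<odot> (a [^] N \<otimes> b [^] N) \<ominus> d ^ N \<odot> (br c a b [^] N)"
proof -
  define M where "M = (N - 1) div 2"
  have N: "N = 2 * M + 1" and NM: "(N + 1) div 2 = Suc M"
    using \<open>odd N\<close> by (auto elim!: oddE simp: M_def)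
  \<comment> \<open>The scalar in \<open>serre2_pow_mult_pow\<close> is therefore
    \<open>c^(N M)\<close>. Its inverse is \<open>d^(N M)\<close>, because \<open>q c d = 1\<close>
    and \<open>q^(N M) = 1\<close>.\<close>
  have "(\<Sum>k<N. k) = N * M"
    by (simp add: N lessThan_Suc_atMost Sum_Icc_nat atMost_atLeast0)
  then have "(\<Prod>k<N. c ^ k) = c ^ (N * M)"
    by (simp flip: power_sum)
  moreover have "q ^ (N * M) * c ^ (N * M) * d ^ (N * M) = 1"
    using qcd by (simp flip: power_mult_distrib)
  moreover have "q ^ (N * M) = 1"
    using q(1) by (simp add: root_of_unity_of_order_def power_mult)
  ultimately have cd: "d ^ (N * M) * (\<Prod>k<N. c ^ k) = 1"
    by (simp add: mult.commute)
  have "hom_eval N (\<Prod>k<N. [:q ^ Suc k, 1:]) (br d b a) (d \<odot> br c a b) =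
      br d b a [^] N \<oplus> d ^ N \<odot> (br c a b [^] N)"
    unfolding prod_linear_roots_of_unity[OF q]
    by (simp add: hom_eval_add hom_eval_monom hom_eval_1 one_smult smult_pow)
  then have *: "d ^ (N * M) \<odot> (((q - 1) * d) ^ N \<odot> (a [^] N \<otimes> b [^] N)) =
      br d b a [^] N \<oplus> d ^ N \<odot> (br c a b [^] N)"
    unfolding serre2_pow_mult_pow[OF S qcd, simplified]
    by (simp add: smult_smult one_smult cd)
  have "((q - 1) ^ N * d ^ (N * ((N + 1) div 2))) \<odot> (a [^] N \<otimes> b [^] N) =
      br d b a [^] N \<oplus> d ^ N \<odot> (br c a b [^] N)"
  proof -
    have "d ^ (N * M) * ((q - 1) * d) ^ N = (q - 1) ^ N * d ^ (N * ((N + 1) div 2))"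
      unfolding NM by (simp add: power_mult_distrib power_add)
    then show ?thesis
      using * by (simp add: smult_smult)
  qed
  then show ?thesis
    by (simp add: minus_eq a_assoc r_neg)
qed

end

section \<open>Increasing sequences\<close>

definition seqs_upto :: "nat \<Rightarrow> nat \<Rightarrow> nat list set"
  where "seqs_upto i k = {p. p \<noteq> [] \<and> hd p = i \<and> last p \<le> k \<and> sorted_wrt (<) p}"

lemma sorted_wrt_less_last:
  fixes p :: "nat list"
  assumes "sorted_wrt (<) p" "a \<in> set p"
  shows "a \<le> last p"
  using assms by (induction p rule: rev_induct) (auto simp: sorted_wrt_append less_imp_le)

lemma sorted_wrt_less_hd:
  fixes p :: "nat list"
  assumes "sorted_wrt (<) p" "a \<in> set p"
  shows "hd p \<le> a"
  using assms by (cases p) auto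

lemma finite_seqs_upto: "finite (seqs_upto i k)"
proof (rule finite_subset)
  show "seqs_upto i k \<subseteq> {p. set p \<subseteq> {..k} \<and> distinct p}"
    using sorted_wrt_less_last by (fastforce simp: seqs_upto_def strict_sorted_iff)
  show "finite {p. set p \<subseteq> {..k} \<and> distinct p}"
    by (rule finite_subset_distinct) simp
qed

lemma seqs_upto_self: "seqs_upto i i = {[i]}"
proof -
  have "p = [i]" if "p \<noteq> []" "hd p = i" "last p \<le> i" "sorted_wrt (<) p" for p
  proof (cases p)
    case (Cons a r)
    then have "r = []"
      using that by (cases r rule: rev_cases) auto
    then show ?thesis
      using that Cons by simp
  qed (use that in simp)
  then show ?thesis
    by (auto simp: seqs_upto_def)
qed

text \<open>As the two ends differ, length at least two is automatic.\<close>

lemma index_seqs_iff: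
  assumes "i < j"
  shows "p \<in> index_seqs i j \<longleftrightarrow> p \<noteq> [] \<and> hd p = i \<and> last p = j \<and> sorted_wrt (<) p"
proof -
  have "2 \<le> length p" if "p \<noteq> []" "hd p = i" "last p = j"
    using that assms by (cases p; cases "tl p") (auto simp: Suc_le_eq)
  then show ?thesis
    by (auto simp: index_seqs_def)
qed

lemma seqs_upto_Suc:
  assumes "i \<le> k"
  shows "seqs_upto i (Suc k) = seqs_upto i k \<union> index_seqs i (Suc k)"
    and "seqs_upto i k \<inter> index_seqs i (Suc k) = {}"
  using assms by (auto simp: seqs_upto_def index_seqs_iff)

lemma index_seqs_eq_snoc:
  assumes "i < j"
  shows "index_seqs i j = (\<lambda>p. p @ [j]) ` seqs_upto i (j - 1)"
proof (intro equalityI subsetI)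
  fix p assume "p \<in> index_seqs i j"
  then have p: "2 \<le> length p" "hd p = i" "last p = j" "sorted_wrt (<) p"
    by (auto simp: index_seqs_def)
  obtain r where r: "p = r @ [j]" "r \<noteq> []"
    using p by (cases p rule: rev_cases) (auto simp: Suc_le_eq)
  have "\<forall>x\<in>set r. x < j"
    using p(4) by (simp add: r(1) sorted_wrt_append)
  then have "last r < j"
    using r(2) by simp
  then have "last r \<le> j - 1"
    by linarith
  then have "r \<in> seqs_upto i (j - 1)"
    using p r by (auto simp: seqs_upto_def sorted_wrt_append)
  then show "p \<in> (\<lambda>p. p @ [j]) ` seqs_upto i (j - 1)"
    using r by auto
next
  fix p assume "p \<in> (\<lambda>p. p @ [j]) ` seqs_upto i (j - 1)"
  then obtain r where r: "p = r @ [j]" "r \<noteq> []" "hd r = i" "last r \<le> j - 1" "sorted_wrt (<) r"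
    by (auto simp: seqs_upto_def)
  then have "x < j" if "x \<in> set r" for x
    using sorted_wrt_less_last[OF r(5) that] assms by auto
  then show "p \<in> index_seqs i j"
    using r assms by (auto simp: index_seqs_iff sorted_wrt_append)
qed

lemma zip_tl_snoc:
  "p \<noteq> [] \<Longrightarrow> zip (p @ [j]) (tl (p @ [j])) = zip p (tl p) @ [(last p, j)]"
  by (induction p) (auto simp: neq_Nil_conv)

lemma zip_tl_sorted:
  fixes p :: "nat list"
  assumes "(a, b) \<in> set (zip p (tl p))" "sorted_wrt (<) p"
  shows "hd p \<le> a" "a < b" "b \<le> last p"
proof -
  obtain m where m: "m < length (tl p)" "a = p ! m" "b = tl p ! m"
    using assms by (auto simp: set_zip)
  then have b: "b = p ! Suc m" and m': "Suc m < length p"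
    by (auto simp: nth_tl)
  then show "a < b"
    using assms(2) m by (simp add: sorted_wrt_nth_less)
  show "hd p \<le> a" "b \<le> last p"
    unfolding b m(2) using m' by (auto intro!: sorted_wrt_less_hd sorted_wrt_less_last assms(2))
qed

lemma seqs_upto_bounds:
  assumes "p \<in> seqs_upto i k"
  shows "p \<noteq> []" "i \<le> last p" "last p \<le> k"
  using assms sorted_wrt_less_hd[of p "last p"] by (auto simp: seqs_upto_def)

section \<open>Root vectors\<close>

text \<open>The interface between the presentation of \<open>R_alg D\<close> and the computation
  with root vectors: the relations among generators enter only through these assumptions, which
  \<open>type_A_datumI\<close> establishes.\<close>

locale type_A_datum = scalar_ring "R_alg D"
  for D :: "('g, 'k::field) datum" +
  fixes q :: 'k and N :: nat
  assumes datum: "datum_of_type_A D q N"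
    and gen_closed: "i \<in> {1..datum_rank D} \<Longrightarrow> gen D i \<in> carrier (R_alg D)"
    and gen_qcomm: "i \<in> {1..datum_rank D} \<Longrightarrow> j \<in> {1..datum_rank D} \<Longrightarrow> Suc i < j
      \<Longrightarrow> qcomm (braiding D i j) (gen D i) (gen D j)"
    and gen_serre2: "i \<in> {1..datum_rank D} \<Longrightarrow> Suc i \<in> {1..datum_rank D}
      \<Longrightarrow> serre2 q (braiding D i (Suc i)) (gen D i) (gen D (Suc i))"
begin

abbreviation (input) n where "n \<equiv> datum_rank D"
abbreviation (input) b where "b \<equiv> braiding D"
abbreviation (input) X where "X \<equiv> root_vector D"
abbreviation (input) Y where "Y \<equiv> rev_root_vector D"

section \<open>Scalars of the datum and braiding factors between intervals\<close>

lemma unity: "root_of_unity_of_order q N" and N_gt_1: "1 < N" and N_odd: "odd N"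
  using datum by (auto simp: datum_of_type_A_def)

lemma q_nonzero: "q \<noteq> 0"
  using unity by (auto simp: root_of_unity_of_order_def zero_power)

text \<open>Otherwise \<open>q^2 = 1\<close>, whereas the order \<open>N\<close> is odd and greater
  than 1, hence at least 3. This permits the cancellation in \<open>serre2_middle\<close>.\<close>

lemma one_plus_q_nonzero: "1 + q \<noteq> 0"
proof
  assume "1 + q = 0"
  then have "q ^ 2 = 1"
    by (simp add: add_eq_0_iff)
  moreover have "2 < N"
    using N_gt_1 N_odd by (cases "N = 2") auto
  ultimately show False
    using unity by (auto simp: root_of_unity_of_order_def)
qed

lemma b_nonzero:
  assumes "i \<in> {1..n}" "j \<in> {1..n}"
  shows "b i j \<noteq> 0"
proof -
  have "datum_chr D j \<in> hom (datum_group D) units_group" "datum_elt D i \<in> carrier (datum_group D)"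
    using datum assms by (auto simp: datum_of_type_A_def)
  then have "datum_chr D j (datum_elt D i) \<in> carrier units_group"
    by (rule hom_in_carrier)
  then show ?thesis
    by (simp add: braiding_def units_group_def)
qed

text \<open>The braiding factor between \<open>x\<^sub>i\<^sub>j\<close> and \<open>x\<^sub>k\<^sub>l\<close>, that is, \<open>\<chi>\<^sub>k\<^sub>l(g\<^sub>i\<^sub>j)\<close>.\<close>

definition bc :: "nat \<Rightarrow> nat \<Rightarrow> nat \<Rightarrow> nat \<Rightarrow> 'k"
  where "bc i j k l = (\<Prod>r\<in>{i..<j}. \<Prod>s\<in>{k..<l}. b r s)"

lemma bc_nonzero:
  assumes "1 \<le> i" "j \<le> n + 1" "1 \<le> k" "l \<le> n + 1"
  shows "bc i j k l \<noteq> 0"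
  using assms by (auto simp: bc_def b_nonzero)

lemma bc_split_left: "i \<le> m \<Longrightarrow> m \<le> j \<Longrightarrow> bc i j k l = bc i m k l * bc m j k l"
  by (simp add: bc_def prod.atLeastLessThan_concat)

lemma bc_split_right: "k \<le> m \<Longrightarrow> m \<le> l \<Longrightarrow> bc i j k l = bc i j k m * bc i j m l"
  by (simp add: bc_def prod.atLeastLessThan_concat flip: prod.distrib)

lemma bc_mult_swap: "bc i j k l * bc k l i j = (\<Prod>r\<in>{i..<j}. \<Prod>s\<in>{k..<l}. b r s * b s r)"
proof -
  have "bc k l i j = (\<Prod>r\<in>{i..<j}. \<Prod>s\<in>{k..<l}. b s r)"
    unfolding bc_def by (rule prod.swap)
  then show ?thesis
    by (simp add: bc_def prod.distrib)
qed

text \<open>The index \<open>k\<close> lies between the two intervals, so no index of one is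
  adjacent to an index of the other.\<close>

lemma bc_mult_swap_far:
  assumes "1 \<le> i" "k < m" "j \<le> n + 1"
  shows "bc i k m j * bc m j i k = 1"
proof -
  have "b r s * b s r = 1" if "r \<in> {i..<k}" "s \<in> {m..<j}" for r s
  proof -
    have "r \<in> {1..n}" "s \<in> {1..n}" "Suc r < s"
      using that assms by auto
    then show ?thesis
      using datum unfolding datum_of_type_A_def by blast
  qed
  then show ?thesis
    by (simp add: bc_mult_swap)
qed

text \<open>The only adjacent pair is \<open>k - 1\<close> and \<open>k\<close>; it contributes
  \<open>inverse q\<close>, and all other pairs contribute 1.\<close>

lemma bc_mult_swap_near:
  assumes "1 \<le> i" "i < k" "k < j" "j \<le> n + 1"
  shows "q * bc i k k j * bc k j i k = 1"
proof -
  obtain k' where k: "k = Suc k'"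
    using assms by (cases k) auto
  have "k' \<in> {1..n}" "k \<in> {1..n}"
    using assms k by auto
  then have inv: "b k' k * b k k' = inverse q"
    using datum k unfolding datum_of_type_A_def by blast
  have 1: "bc i k' k j * bc k j i k' = 1" "bc k' k (Suc k) j * bc (Suc k) j k' k = 1"
    using assms k by (auto intro: bc_mult_swap_far)
  have "bc i k k j * bc k j i k =
      (bc i k' k j * bc k j i k') * ((bc k' k (Suc k) j * bc (Suc k) j k' k) * (bc k' k k (Suc k) * bc k (Suc k) k' k))"
  proof -
    have "bc i k k j = bc i k' k j * (bc k' k k (Suc k) * bc k' k (Suc k) j)"
      using assms k bc_split_left[of i k' k k j] bc_split_right[of k "Suc k" j k' k] by simp
    moreover have "bc k j i k = bc k j i k' * (bc k (Suc k) k' k * bc (Suc k) j k' k)"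
      using assms k bc_split_right[of i k' k k j] bc_split_left[of k "Suc k" j k' k] by simp
    ultimately show ?thesis
      by (simp only: mult_ac)
  qed
  also have "\<dots> = inverse q"
    using inv unfolding 1 by (simp add: bc_def k)
  finally show ?thesis
    using q_nonzero by (simp add: mult.assoc)
qed

section \<open>Skew commutation and Serre relations of root vectors\<close>

lemma root_vector_Suc: "X i (Suc i) = gen D i"
  by (subst root_vector.simps) simp

lemma rev_root_vector_Suc: "Y (Suc i) i = gen D i"
  by (subst rev_root_vector.simps) simp

lemma root_vector_step:
  "Suc i < j \<Longrightarrow> X i j = br (bc i (Suc i) (Suc i) j) (gen D i) (X (Suc i) j)"
  by (subst root_vector.simps) (simp add: br_def bc_def chr_prod_def braiding_def)

lemma rev_root_vector_step:
  "i < j \<Longrightarrow> Y (Suc j) i = br (bc j (Suc j) i j) (gen D j) (Y j i)"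
  by (subst rev_root_vector.simps) (simp add: br_def bc_def chr_prod_def braiding_def)

lemma root_vector_closed:
  assumes "1 \<le> i" "i < j" "j \<le> n + 1"
  shows "X i j \<in> carrier (R_alg D)"
  using assms(2,1,3)
proof (induction rule: strict_inc_induct)
  case (base i)
  then show ?case
    by (simp add: root_vector_Suc gen_closed)
next
  case (step i)
  \<comment> \<open>The step of \<open>strict_inc_induct\<close> assumes only \<open>i < j\<close>,
    so a single generator occurs here again.\<close>
  show ?case
  proof (cases "Suc i = j")
    case True
    then show ?thesis
      using step.prems by (auto simp: root_vector_Suc gen_closed)
  next
    case False
    then show ?thesis
      using step by (subst root_vector_step) (auto intro!: br_closed gen_closed)
  qed
qed

lemma rev_root_vector_closed:
  assumes "1 \<le> i" "i < j" "j \<le> n + 1"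
  shows "Y j i \<in> carrier (R_alg D)"
  using assms(2,3)
proof (induction j)
  case (Suc j)
  then show ?case
    using assms(1) by (cases "i = j") (auto simp: rev_root_vector_Suc rev_root_vector_step gen_closed)
qed simp

text \<open>Descending induction on \<open>k\<close>: \<open>X k j\<close> is a commutator of
  \<open>gen D k\<close> and \<open>X (Suc k) j\<close>, which involve no neighbour of
  \<open>i\<close>.\<close>

lemma gen_root_vector_qcomm:
  assumes "1 \<le> i" "Suc i < k" "k < j" "j \<le> n + 1"
  shows "qcomm (bc i (Suc i) k j) (gen D i) (X k j)"
  using assms(3,1,2,4)
proof (induction rule: strict_inc_induct)
  case (base k)
  then show ?case
    by (simp add: root_vector_Suc bc_def gen_qcomm)
next
  case (step k)
  have "qcomm (bc i (Suc i) k (Suc k) * bc i (Suc i) (Suc k) j) (gen D i) (X k j)"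
  proof (cases "Suc k = j")
    case True
    then show ?thesis
      using step.prems unfolding True[symmetric] by (simp add: root_vector_Suc bc_def gen_qcomm)
  next
    case False
    then have "Suc k < j"
      using step.hyps by simp
    then show ?thesis
      unfolding root_vector_step[OF \<open>Suc k < j\<close>] using step
      by (intro qcomm_br) (auto simp: bc_def gen_qcomm gen_closed root_vector_closed)
  qed
  then show ?case
    using step.hyps bc_split_right[of k "Suc k" j i "Suc i"] by simp
qed

text \<open>Induction on \<open>k\<close>, adding one generator to \<open>Y k i\<close> at a time;
  \<open>k < m\<close> keeps the two intervals apart.\<close>

lemma rev_root_vector_root_vector_qcomm:
  assumes "1 \<le> i" "i < k" "k < m" "m < j" "j \<le> n + 1"
  shows "qcomm (bc i k m j) (Y k i) (X m j)"
  using assms(2,3)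
proof (induction k)
  case (Suc k)
  show ?case
  proof (cases "i = k")
    case True
    then show ?thesis
      using gen_root_vector_qcomm[of i m j] Suc.prems assms by (simp add: rev_root_vector_Suc)
  next
    case False
    then have "i < k"
      using Suc.prems by simp
    have "qcomm (bc k (Suc k) m j * bc i k m j) (Y (Suc k) i) (X m j)"
      unfolding rev_root_vector_step[OF \<open>i < k\<close>] using Suc assms \<open>i < k\<close>
      by (intro qcomm_br_left gen_root_vector_qcomm Suc.IH bc_nonzero gen_closed root_vector_closed
          rev_root_vector_closed) auto
    then show ?thesis
      using \<open>i < k\<close> bc_split_left[of i k "Suc k" m j] by (simp add: mult.commute)
  qed
qed simp

text \<open>Induction on \<open>j - i\<close>. If \<open>X k j\<close> is not a generator, it is a
  commutator and \<open>serre2_br\<close> extends the pair on the right; if \<open>Y k i\<close> is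
  not, the same is done with the two sides exchanged; otherwise the pair consists of adjacent
  generators.\<close>

lemma serre2_root_vectors:
  assumes "1 \<le> i" "i < k" "k < j" "j \<le> n + 1"
  shows "serre2 q (bc i k k j) (Y k i) (X k j)"
  using assms
proof (induction "j - i" arbitrary: i k j rule: less_induct)
  case less
  have nz: "1 + q \<noteq> 0" "q \<noteq> 0"
    using one_plus_q_nonzero q_nonzero by auto
  obtain k' where k': "k = Suc k'"
    using less.prems by (cases k) auto
  consider (gens) "i = k'" "j = Suc k" | (right) "Suc k < j" | (left) "i < k'"
    using less.prems k' by linarith
  then show ?case
  proof cases
    case gens
    then show ?thesis
      using gen_serre2[of i] less.prems k' by (simp add: bc_def rev_root_vector_Suc root_vector_Suc)
  next
    case right
    have "serre2 q (bc i k k (Suc k) * bc i k (Suc k) j) (Y k i)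
        (br (bc k (Suc k) (Suc k) j) (X k (Suc k)) (X (Suc k) j))"
    proof (rule serre2_br)
      show "serre2 q (bc i k k (Suc k)) (Y k i) (X k (Suc k))"
        using less.prems right by (intro less.hyps) auto
      have "serre2 q (bc k (Suc k) (Suc k) j) (Y (Suc k) k) (X (Suc k) j)"
        using less.prems right by (intro less.hyps) auto
      then show "serre2 q (bc k (Suc k) (Suc k) j) (X k (Suc k)) (X (Suc k) j)"
        by (simp add: root_vector_Suc rev_root_vector_Suc)
      show "qcomm (bc i k (Suc k) j) (Y k i) (X (Suc k) j)"
        using less.prems right by (intro rev_root_vector_root_vector_qcomm) auto
    qed (use less.prems right nz in \<open>simp_all add: bc_nonzero rev_root_vector_closed root_vector_closed\<close>)
    then show ?thesis
      using right bc_split_right[of k "Suc k" j i k] by (simp add: root_vector_step[OF right] root_vector_Suc)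
  next
    case left
    \<comment> \<open>\<open>Y k i\<close> is the commutator of \<open>Y k k'\<close> and
      \<open>Y k' i\<close>, so \<open>serre2_br\<close> is applied to \<open>X k j\<close>,
      \<open>Y k k'\<close>, \<open>Y k' i\<close>; \<open>serre2_sym\<close> reverses the pairs
      before and after.\<close>
    have "serre2 q (bc k j k' k * bc k j i k') (X k j) (br (bc k' k i k') (Y k k') (Y k' i))"
    proof (rule serre2_br)
      have "serre2 q (bc k' k k j) (Y k k') (X k j)"
        using less.prems left k' by (intro less.hyps) auto
      then show "serre2 q (bc k j k' k) (X k j) (Y k k')"
        by (rule serre2_sym) (use less.prems left k' in
            \<open>auto intro!: bc_mult_swap_near rev_root_vector_closed root_vector_closed\<close>)
      have "serre2 q (bc i k' k' k) (Y k' i) (X k' k)"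
        using less.prems left k' by (intro less.hyps) auto
      then have "serre2 q (bc k' k i k') (X k' k) (Y k' i)"
        by (rule serre2_sym) (use less.prems left k' in
            \<open>auto intro!: bc_mult_swap_near rev_root_vector_closed root_vector_closed\<close>)
      then show "serre2 q (bc k' k i k') (Y k k') (Y k' i)"
        using left k' by (simp add: root_vector_Suc rev_root_vector_Suc)
      have "qcomm (bc i k' k j) (Y k' i) (X k j)"
        using less.prems left k' by (intro rev_root_vector_root_vector_qcomm) auto
      then show "qcomm (bc k j i k') (X k j) (Y k' i)"
        by (rule qcomm_sym) (use less.prems left k' in
            \<open>auto intro!: bc_mult_swap_far rev_root_vector_closed root_vector_closed\<close>)
    qed (use less.prems left k' nz in \<open>simp_all add: bc_nonzero rev_root_vector_closed root_vector_closed\<close>)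
    moreover have "bc k j k' k * bc k j i k' = bc k j i k"
      using left k' bc_split_right[of i k' k k j] by (simp add: mult.commute)
    moreover have "br (bc k' k i k') (Y k k') (Y k' i) = Y k i"
      using left k' by (simp add: rev_root_vector_step[of i k'] rev_root_vector_Suc)
    ultimately have "serre2 q (bc k j i k) (X k j) (Y k i)"
      by simp
    then show ?thesis
      by (rule serre2_sym) (use less.prems bc_mult_swap_near[of i k j] in
          \<open>auto intro!: rev_root_vector_closed root_vector_closed simp: mult_ac\<close>)
  qed
qed

text \<open>The reverse root vector of the simple root vectors \<open>x\<^sub>i, \<dots>, x\<^sub>k\<^sub>-\<^sub>1\<close> followed by \<open>x\<^sub>k\<^sub>j\<close> as last one;
  it interpolates between \<open>x\<^sub>i\<^sub>j\<close> (for \<open>k = i\<close>) and \<open>x\<^sub>j\<^sub>i\<close> (for \<open>k = j - 1\<close>).\<close>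

definition mixed :: "nat \<Rightarrow> nat \<Rightarrow> nat \<Rightarrow> 'k ncpoly set"
  where "mixed i k j = (if k = i then X i j else br (bc k j i k) (X k j) (Y k i))"

lemma mixed_closed:
  assumes "1 \<le> i" "i \<le> k" "k < j" "j \<le> n + 1"
  shows "mixed i k j \<in> carrier (R_alg D)"
  using assms by (auto simp: mixed_def intro!: br_closed root_vector_closed rev_root_vector_closed)

lemma rev_root_vector_eq_mixed: "i < Suc j \<Longrightarrow> Y (Suc j) i = mixed i j (Suc j)"
  by (auto simp: mixed_def root_vector_Suc rev_root_vector_Suc rev_root_vector_step)

text \<open>On the left, \<open>gen D k\<close> is commuted first with \<open>Y k i\<close> and then
  with \<open>X (Suc k) j\<close>; \<open>br_br_swap\<close> changes the order. For
  \<open>k = i\<close> there is no \<open>Y k i\<close>, and the factor is an empty product.\<close>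

lemma br_eq_mixed:
  assumes "1 \<le> i" "i \<le> k" "Suc k < j" "j \<le> n + 1"
  shows "br (bc i (Suc k) (Suc k) j) (Y (Suc k) i) (X (Suc k) j) = bc i k (Suc k) j \<odot>\<^bsub>R_alg D\<^esub> mixed i k j"
proof (cases "i = k")
  case True
  then show ?thesis
    using assms root_vector_closed[of i j]
    by (simp add: mixed_def rev_root_vector_Suc bc_def[of k k] one_smult flip: root_vector_step[of k j])
next
  case False
  then have "i < k"
    using assms by simp
  have far: "bc i k (Suc k) j * bc (Suc k) j i k = 1"
    using assms by (intro bc_mult_swap_far) auto
  \<comment> \<open>The factors are put into the form \<open>d * e\<close> and \<open>c * d\<close>
    required by \<open>br_br_swap\<close>, where \<open>d\<close> is the factor between
    \<open>Y k i\<close> and \<open>X (Suc k) j\<close>.\<close>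
  have "bc i k (Suc k) j * bc k j i k = (bc i k (Suc k) j * bc (Suc k) j i k) * bc k (Suc k) i k"
    using assms bc_split_left[of k "Suc k" j i k] by simp
  then have e: "bc k (Suc k) i k = bc i k (Suc k) j * bc k j i k"
    by (simp add: far)
  have c: "bc i (Suc k) (Suc k) j = bc k (Suc k) (Suc k) j * bc i k (Suc k) j"
    using assms bc_split_left[of i k "Suc k" "Suc k" j] by simp
  have "br (bc i (Suc k) (Suc k) j) (Y (Suc k) i) (X (Suc k) j) =
      bc i k (Suc k) j \<odot>\<^bsub>R_alg D\<^esub> br (bc k j i k) (br (bc k (Suc k) (Suc k) j) (gen D k) (X (Suc k) j)) (Y k i)"
    unfolding rev_root_vector_step[OF \<open>i < k\<close>] c e using assms \<open>i < k\<close>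
    by (intro br_br_swap rev_root_vector_root_vector_qcomm gen_closed root_vector_closed rev_root_vector_closed) auto
  then show ?thesis
    using False assms by (simp add: mixed_def root_vector_step[of k j])
qed

text \<open>This is \<open>serre2_br_pow\<close> for \<open>Y (Suc k) i\<close> and
  \<open>X (Suc k) j\<close>, with the last term rewritten by \<open>br_eq_mixed\<close>. There the
  factors between \<open>{i..<k}\<close> and \<open>{Suc k..<j}\<close> cancel, which leaves those
  that involve the index \<open>k\<close>.\<close>

lemma mixed_pow_Suc:
  assumes "1 \<le> i" "i \<le> k" "Suc k < j" "j \<le> n + 1"
  shows "mixed i (Suc k) j [^]\<^bsub>R_alg D\<^esub> N =
    ((q - 1) ^ N * bc (Suc k) j i (Suc k) ^ (N * ((N + 1) div 2))) \<odot>\<^bsub>R_alg D\<^esub>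
      (Y (Suc k) i [^]\<^bsub>R_alg D\<^esub> N \<otimes>\<^bsub>R_alg D\<^esub> X (Suc k) j [^]\<^bsub>R_alg D\<^esub> N)
    \<ominus>\<^bsub>R_alg D\<^esub> bc (Suc k) j k (Suc k) ^ N \<odot>\<^bsub>R_alg D\<^esub> (mixed i k j [^]\<^bsub>R_alg D\<^esub> N)"
proof -
  have YX: "Y (Suc k) i \<in> carrier (R_alg D)" "X (Suc k) j \<in> carrier (R_alg D)" "mixed i k j \<in> carrier (R_alg D)"
    using assms by (auto intro!: rev_root_vector_closed root_vector_closed mixed_closed)
  have "bc (Suc k) j i (Suc k) * bc i k (Suc k) j = (bc i k (Suc k) j * bc (Suc k) j i k) * bc (Suc k) j k (Suc k)"
    using assms bc_split_right[of i k "Suc k" "Suc k" j] by (simp add: mult_ac)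
  also have "bc i k (Suc k) j * bc (Suc k) j i k = 1"
    using assms by (intro bc_mult_swap_far) auto
  finally have c: "bc (Suc k) j i (Suc k) ^ N * bc i k (Suc k) j ^ N = bc (Suc k) j k (Suc k) ^ N"
    by (simp flip: power_mult_distrib)
  have z: "br (bc i (Suc k) (Suc k) j) (Y (Suc k) i) (X (Suc k) j) [^]\<^bsub>R_alg D\<^esub> N =
      bc i k (Suc k) j ^ N \<odot>\<^bsub>R_alg D\<^esub> (mixed i k j [^]\<^bsub>R_alg D\<^esub> N)"
    unfolding br_eq_mixed[OF assms] by (rule smult_pow) (rule YX)
  have "serre2 q (bc i (Suc k) (Suc k) j) (Y (Suc k) i) (X (Suc k) j)"
    using assms by (intro serre2_root_vectors) auto
  moreover have "q * bc i (Suc k) (Suc k) j * bc (Suc k) j i (Suc k) = 1"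
    using assms by (intro bc_mult_swap_near) auto
  ultimately have "br (bc (Suc k) j i (Suc k)) (X (Suc k) j) (Y (Suc k) i) [^]\<^bsub>R_alg D\<^esub> N =
    ((q - 1) ^ N * bc (Suc k) j i (Suc k) ^ (N * ((N + 1) div 2))) \<odot>\<^bsub>R_alg D\<^esub>
      (Y (Suc k) i [^]\<^bsub>R_alg D\<^esub> N \<otimes>\<^bsub>R_alg D\<^esub> X (Suc k) j [^]\<^bsub>R_alg D\<^esub> N)
    \<ominus>\<^bsub>R_alg D\<^esub> bc (Suc k) j i (Suc k) ^ N \<odot>\<^bsub>R_alg D\<^esub>
      (br (bc i (Suc k) (Suc k) j) (Y (Suc k) i) (X (Suc k) j) [^]\<^bsub>R_alg D\<^esub> N)"
    by (rule serre2_br_pow[OF _ _ unity N_odd YX(1,2)])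
  moreover have "mixed i (Suc k) j = br (bc (Suc k) j i (Suc k)) (X (Suc k) j) (Y (Suc k) i)"
    using assms by (simp add: mixed_def)
  ultimately show ?thesis
    unfolding z smult_smult[OF nat_pow_closed[OF YX(3)]] c by simp
qed

section \<open>Recursions for \<open>tau\<close> and the coefficients \<open>t\<close>\<close>

text \<open>The pairs with both indices below \<open>l\<close>, or both at least \<open>l\<close>,
  give the two values of \<open>tau\<close>; the pairs separated by \<open>l\<close> give the power
  of \<open>bc\<close>.\<close>

lemma tau_split:
  assumes "i \<le> l" "l \<le> j"
  shows "tau D N i j = tau D N i l * tau D N l j * bc l j i l ^ N"
proof -
  let ?S = "\<lambda>i j. {(k, m). i \<le> k \<and> k < m \<and> m < (j::nat)}"
  let ?P = "\<lambda>A. \<Prod>(k, m)\<in>A. b m k ^ N"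
  have fin: "finite (?S i j)" for i j
    by (rule finite_subset[of _ "{..j} \<times> {..j}"]) auto
  have "?S i j = (?S i l \<union> ?S l j) \<union> {i..<l} \<times> {l..<j}"
    using assms by auto
  then have "?P (?S i j) = ?P ((?S i l \<union> ?S l j) \<union> {i..<l} \<times> {l..<j})"
    by simp
  also have "\<dots> = ?P (?S i l \<union> ?S l j) * ?P ({i..<l} \<times> {l..<j})"
    using fin by (intro prod.union_disjoint) auto
  also have "?P (?S i l \<union> ?S l j) = ?P (?S i l) * ?P (?S l j)"
    using fin by (intro prod.union_disjoint) auto
  also have "?P ({i..<l} \<times> {l..<j}) = (\<Prod>k\<in>{i..<l}. \<Prod>m\<in>{l..<j}. b m k ^ N)"
    by (simp add: prod.cartesian_product)
  also have "\<dots> = bc l j i l ^ N"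
    unfolding bc_def prod_power_distrib by (rule prod.swap)
  finally show ?thesis
    by (simp add: tau_def)
qed

lemma tau_Suc: "tau D N i (Suc i) = 1"
proof -
  have empty: "{(k, m). i \<le> k \<and> k < m \<and> m < Suc i} = {}"
    by auto
  show ?thesis
    unfolding tau_def empty by simp
qed

lemma tau_nonzero:
  assumes "1 \<le> i" "j \<le> n + 1"
  shows "tau D N i j \<noteq> 0"
proof -
  have "finite {(k, m). i \<le> k \<and> k < m \<and> m < j}"
    by (rule finite_subset[of _ "{..j} \<times> {..j}"]) auto
  then show ?thesis
    using assms by (auto simp: tau_def b_nonzero)
qed

lemma tau_chain_snoc:
  assumes "p \<noteq> []"
  shows "tau_chain D N (p @ [j]) = tau_chain D N p * tau D N (last p) j"
  unfolding tau_chain_def zip_tl_snoc[OF assms] by simp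

text \<open>The chain is \<open>tau D N i j\<close> itself, and the exponents
  \<open>-(N-1)/2\<close> and \<open>(N+1)/2\<close> add up to 1.\<close>

lemma t_coeff_pair:
  assumes "1 \<le> i" "i < j" "j \<le> n + 1"
  shows "t_coeff D q N i j [i, j] = (- 1) ^ (j - 1 - i) * tau D N i j"
proof -
  have "(N + 1) div 2 = Suc ((N - 1) div 2)"
    using N_odd by (auto elim!: oddE)
  moreover have sgn: "int j - int i - int (length [i, j]) + 1 = int (j - 1 - i)"
    using assms by simp
  ultimately show ?thesis
    unfolding t_coeff_def sgn power_int_of_nat using tau_nonzero[of i j] assms
    by (simp add: tau_chain_def power_int_minus)
qed

text \<open>The factors on the right are the scalar in \<open>mixed_pow_eq_sum\<close> at
  \<open>k = l\<close>, the coefficient from \<open>mixed_pow_Suc\<close>, and the coefficient of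
  \<open>p\<close>. By \<open>tau_split\<close>, \<open>tau D N l j\<close> occurs with exponent
  \<open>-M\<close> from the chain and \<open>M + 1\<close> from \<open>tau D N i j\<close>, so that
  one factor remains.\<close>

lemma t_coeff_snoc:
  assumes "1 \<le> i" "i < l" "l < j" "j \<le> n + 1" and p: "p \<in> index_seqs i l"
  shows "t_coeff D q N i j (p @ [j]) = (- 1) ^ (j - 1 - l) * tau D N l j *
    ((q - 1) ^ N * bc l j i l ^ (N * ((N + 1) div 2))) * t_coeff D q N i l p"
proof -
  define M where "M = (N - 1) div 2"
  have M: "(N + 1) div 2 = Suc M"
    using N_odd by (auto elim!: oddE simp: M_def)
  have p': "p \<noteq> []" "last p = l" "length p \<ge> 2"
    using p by (auto simp: index_seqs_def)
  have len: "length (p @ [j]) - 2 = Suc (length p - 2)"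
    using p' by simp
  have "int j - int i - int (length (p @ [j])) + 1 = (int l - int i - int (length p) + 1) + int (j - 1 - l)"
    using assms by simp
  then have sgn: "(- 1 :: 'k) powi (int j - int i - int (length (p @ [j])) + 1) =
      (- 1) powi (int l - int i - int (length p) + 1) * (- 1) ^ (j - 1 - l)"
    by (simp only: power_int_of_nat power_int_add neg_equal_0_iff_equal one_neq_zero simp_thms not_False_eq_True)
  have tau: "(tau_chain D N p * tau D N l j) powi (- int M) * tau D N i j ^ Suc M =
      tau_chain D N p powi (- int M) * tau D N l j * tau D N i l ^ Suc M * bc l j i l ^ (N * Suc M)"
  proof -
    have "tau D N i j ^ Suc M = tau D N i l ^ Suc M * tau D N l j ^ Suc M * bc l j i l ^ (N * Suc M)"
    proof -
      have "tau D N i j = tau D N i l * tau D N l j * bc l j i l ^ N"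
        using assms by (intro tau_split) auto
      then show ?thesis
        by (simp only: power_mult_distrib power_mult)
    qed
    moreover have "tau D N l j powi (- int M) * tau D N l j ^ Suc M = tau D N l j"
      using tau_nonzero[of l j] assms by (simp add: power_int_minus)
    moreover have "(tau_chain D N p * tau D N l j) powi (- int M) *
        (tau D N i l ^ Suc M * tau D N l j ^ Suc M * bc l j i l ^ (N * Suc M)) =
        tau_chain D N p powi (- int M) * (tau D N l j powi (- int M) * tau D N l j ^ Suc M) *
        tau D N i l ^ Suc M * bc l j i l ^ (N * Suc M)"
      by (simp only: power_int_mult_distrib mult_ac)
    ultimately show ?thesis
      by (simp only:)
  qed
  have "t_coeff D q N i j (p @ [j]) =
      (- 1) powi (int l - int i - int (length p) + 1) * (- 1) ^ (j - 1 - l) * (q - 1) ^ (N * Suc (length p - 2)) *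
      ((tau_chain D N p * tau D N l j) powi (- int M) * tau D N i j ^ Suc M)"
    unfolding t_coeff_def M M_def[symmetric] len sgn tau_chain_snoc[OF p'(1)] p'(2) by (simp only: mult.assoc)
  also have "\<dots> = (- 1) ^ (j - 1 - l) * tau D N l j * ((q - 1) ^ N * bc l j i l ^ (N * Suc M)) *
      ((- 1) powi (int l - int i - int (length p) + 1) * (q - 1) ^ (N * (length p - 2)) *
       tau_chain D N p powi (- int M) * tau D N i l ^ Suc M)"
    unfolding tau mult_Suc_right[of N "length p - 2"] power_add by (simp only: mult_ac)
  finally show ?thesis
    unfolding t_coeff_def M M_def[symmetric] .
qed

section \<open>Chains of \<open>N\<close>-th powers and the sum over sequences\<close>

lemma root_power_closed:
  assumes "1 \<le> a" "a < c" "c \<le> n + 1"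
  shows "X a c [^]\<^bsub>R_alg D\<^esub> N \<in> carrier (R_alg D)"
  using root_vector_closed[OF assms] by simp

text \<open>An arbitrary start value splits off as the last factor, which turns appending an index
  into right multiplication. Closure is carried along because associativity in the induction needs
  it.\<close>

lemma foldr_root_powers:
  assumes "\<And>a c. (a, c) \<in> set ps \<Longrightarrow> X a c [^]\<^bsub>R_alg D\<^esub> N \<in> carrier (R_alg D)"
    and y: "y \<in> carrier (R_alg D)"
  shows "foldr (\<lambda>(a, c) y. X a c [^]\<^bsub>R_alg D\<^esub> N \<otimes>\<^bsub>R_alg D\<^esub> y) ps \<one>\<^bsub>R_alg D\<^esub> \<in> carrier (R_alg D) \<and>
    foldr (\<lambda>(a, c) y. X a c [^]\<^bsub>R_alg D\<^esub> N \<otimes>\<^bsub>R_alg D\<^esub> y) ps y =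
    foldr (\<lambda>(a, c) y. X a c [^]\<^bsub>R_alg D\<^esub> N \<otimes>\<^bsub>R_alg D\<^esub> y) ps \<one>\<^bsub>R_alg D\<^esub> \<otimes>\<^bsub>R_alg D\<^esub> y"
  using assms(1)
proof (induction ps)
  case (Cons x ps)
  then show ?case
    using y by (cases x) (simp add: m_assoc)
qed (use y in simp)

lemma seqs_upto_pairs_closed:
  assumes "p \<in> seqs_upto i k" "1 \<le> i" "k \<le> n + 1" "(a, c) \<in> set (zip p (tl p))"
  shows "X a c [^]\<^bsub>R_alg D\<^esub> N \<in> carrier (R_alg D)"
  using zip_tl_sorted[OF assms(4)] assms(1-3)
  by (intro root_power_closed) (auto simp: seqs_upto_def)

lemma root_power_chain_closed:
  assumes "p \<in> seqs_upto i k" "1 \<le> i" "k \<le> n + 1"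
  shows "root_power_chain D N p \<in> carrier (R_alg D)"
  unfolding root_power_chain_def
  using foldr_root_powers[of "zip p (tl p)" "\<one>\<^bsub>R_alg D\<^esub>"] seqs_upto_pairs_closed[OF assms] by blast

lemma root_power_chain_snoc:
  assumes p: "p \<in> seqs_upto i k" "1 \<le> i" "k < j" "j \<le> n + 1"
  shows "root_power_chain D N (p @ [j]) =
    root_power_chain D N p \<otimes>\<^bsub>R_alg D\<^esub> (X (last p) j [^]\<^bsub>R_alg D\<^esub> N)"
proof -
  note p' = seqs_upto_bounds[OF p(1)]
  have X: "X (last p) j [^]\<^bsub>R_alg D\<^esub> N \<in> carrier (R_alg D)"
    using p p' by (intro root_power_closed) auto
  have "X a c [^]\<^bsub>R_alg D\<^esub> N \<in> carrier (R_alg D)" if "(a, c) \<in> set (zip p (tl p))" for a c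
    using seqs_upto_pairs_closed[OF p(1,2) _ that] p by simp
  then show ?thesis
    unfolding root_power_chain_def zip_tl_snoc[OF p'(1)] foldr_append
    using foldr_root_powers[of "zip p (tl p)", OF _ X] X by simp
qed

lemma snoc_term_closed:
  assumes p: "p \<in> seqs_upto i k" "1 \<le> i" "k < j" "j \<le> n + 1"
  shows "c \<odot>\<^bsub>R_alg D\<^esub> root_power_chain D N (p @ [j]) \<in> carrier (R_alg D)"
proof -
  have "X (last p) j [^]\<^bsub>R_alg D\<^esub> N \<in> carrier (R_alg D)"
    using p seqs_upto_bounds[OF p(1)] by (intro root_power_closed) auto
  moreover have "root_power_chain D N p \<in> carrier (R_alg D)"
    using p by (intro root_power_chain_closed[of p i k]) auto
  ultimately show ?thesis
    unfolding root_power_chain_snoc[OF assms] by simp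
qed

text \<open>Induction on \<open>k\<close> with \<open>mixed_pow_Suc\<close>. Its product term,
  expanded by \<open>IH\<close>, yields the sequences whose entry before \<open>j\<close> is
  \<open>Suc k\<close>; its \<open>mixed i k j\<close> term yields the earlier ones. The scalar on
  the left is chosen so that the latter term reappears with its own scalar.\<close>

lemma mixed_pow_eq_sum:
  assumes IH: "\<And>l. i < l \<Longrightarrow> l < j \<Longrightarrow> Y l i [^]\<^bsub>R_alg D\<^esub> N =
      (\<Oplus>\<^bsub>R_alg D\<^esub>p\<in>index_seqs i l. t_coeff D q N i l p \<odot>\<^bsub>R_alg D\<^esub> root_power_chain D N p)"
    and ij: "1 \<le> i" "j \<le> n + 1" and "i \<le> k" "k < j"
  shows "((- 1) ^ (j - 1 - k) * tau D N k j) \<odot>\<^bsub>R_alg D\<^esub> (mixed i k j [^]\<^bsub>R_alg D\<^esub> N) =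
    (\<Oplus>\<^bsub>R_alg D\<^esub>p\<in>seqs_upto i k. t_coeff D q N i j (p @ [j]) \<odot>\<^bsub>R_alg D\<^esub> root_power_chain D N (p @ [j]))"
  using \<open>i \<le> k\<close> \<open>k < j\<close>
proof (induction k rule: dec_induct)
  case base
  then have "X i j [^]\<^bsub>R_alg D\<^esub> N \<in> carrier (R_alg D)"
    using ij by (intro root_power_closed) auto
  then show ?case
    using base ij by (simp add: seqs_upto_self t_coeff_pair mixed_def root_power_chain_def finsum_insert Pi_def)
next
  case (step k)
  let ?t = "\<lambda>p. t_coeff D q N i j (p @ [j]) \<odot>\<^bsub>R_alg D\<^esub> root_power_chain D N (p @ [j])"
  let ?l = "Suc k"
  let ?A = "(q - 1) ^ N * bc ?l j i ?l ^ (N * ((N + 1) div 2))"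
  let ?e = "(- 1) ^ (j - 1 - ?l) * tau D N ?l j"
  have X: "X ?l j [^]\<^bsub>R_alg D\<^esub> N \<in> carrier (R_alg D)"
    using step ij by (intro root_power_closed) auto
  have M: "mixed i k j [^]\<^bsub>R_alg D\<^esub> N \<in> carrier (R_alg D)"
    using step ij mixed_closed[of i k j] by simp
  have sub: "index_seqs i ?l \<subseteq> seqs_upto i ?l"
    using step seqs_upto_Suc(1)[of i k] by auto
  have closed: "?t p \<in> carrier (R_alg D)" if "p \<in> seqs_upto i ?l" for p
    using that step.prems ij by (intro snoc_term_closed) auto
  have chain_closed: "root_power_chain D N p \<in> carrier (R_alg D)" if "p \<in> index_seqs i ?l" for p
    using that sub step ij by (intro root_power_chain_closed[of p i ?l]) auto
  have fin: "finite (index_seqs i ?l)"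
    using sub finite_seqs_upto finite_subset by blast
  have "?e * ?A \<odot>\<^bsub>R_alg D\<^esub> (Y ?l i [^]\<^bsub>R_alg D\<^esub> N \<otimes>\<^bsub>R_alg D\<^esub> X ?l j [^]\<^bsub>R_alg D\<^esub> N)
    = (\<Oplus>\<^bsub>R_alg D\<^esub>p\<in>index_seqs i ?l. ?e * ?A \<odot>\<^bsub>R_alg D\<^esub>
        ((t_coeff D q N i ?l p \<odot>\<^bsub>R_alg D\<^esub> root_power_chain D N p) \<otimes>\<^bsub>R_alg D\<^esub> X ?l j [^]\<^bsub>R_alg D\<^esub> N))"
    using step X chain_closed by (simp add: IH finsum_ldistr[OF fin X] smult_finsum)
  also have "\<dots> = (\<Oplus>\<^bsub>R_alg D\<^esub>p\<in>index_seqs i ?l. ?t p)"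
  proof (rule finsum_cong')
    fix p assume p: "p \<in> index_seqs i ?l"
    then have "last p = ?l"
      by (simp add: index_seqs_def)
    moreover have "root_power_chain D N (p @ [j]) =
      root_power_chain D N p \<otimes>\<^bsub>R_alg D\<^esub> (X (last p) j [^]\<^bsub>R_alg D\<^esub> N)"
      using p sub step.prems ij by (intro root_power_chain_snoc[of p i ?l]) auto
    ultimately show "?e * ?A \<odot>\<^bsub>R_alg D\<^esub>
        ((t_coeff D q N i ?l p \<odot>\<^bsub>R_alg D\<^esub> root_power_chain D N p) \<otimes>\<^bsub>R_alg D\<^esub> X ?l j [^]\<^bsub>R_alg D\<^esub> N) = ?t p"
      using step ij p X chain_closed[OF p]
      by (simp add: t_coeff_snoc[OF ij(1) _ step.prems ij(2) p] smult_mult_left smult_smult)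
  qed (use closed sub in auto)
  finally have new: "?e * ?A \<odot>\<^bsub>R_alg D\<^esub> (Y ?l i [^]\<^bsub>R_alg D\<^esub> N \<otimes>\<^bsub>R_alg D\<^esub> X ?l j [^]\<^bsub>R_alg D\<^esub> N)
    = (\<Oplus>\<^bsub>R_alg D\<^esub>p\<in>index_seqs i ?l. ?t p)" .
  have Yc: "Y ?l i [^]\<^bsub>R_alg D\<^esub> N \<in> carrier (R_alg D)"
    using step ij rev_root_vector_closed[of i ?l] by simp
  have "j - 1 - k = Suc (j - 1 - ?l)"
    using step.prems by simp
  \<comment> \<open>The sign advances by one, and \<open>tau_split\<close> at \<open>?l\<close> has
    the trivial first factor \<open>tau D N k ?l = 1\<close>.\<close>
  then have c: "- (?e * bc ?l j k ?l ^ N) = (- 1) ^ (j - 1 - k) * tau D N k j"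
    using step.prems tau_split[of k ?l j] by (simp add: tau_Suc)
  have "?e \<odot>\<^bsub>R_alg D\<^esub> (mixed i ?l j [^]\<^bsub>R_alg D\<^esub> N) =
      ?e * ?A \<odot>\<^bsub>R_alg D\<^esub> (Y ?l i [^]\<^bsub>R_alg D\<^esub> N \<otimes>\<^bsub>R_alg D\<^esub> X ?l j [^]\<^bsub>R_alg D\<^esub> N)
      \<oplus>\<^bsub>R_alg D\<^esub> (- (?e * bc ?l j k ?l ^ N)) \<odot>\<^bsub>R_alg D\<^esub> (mixed i k j [^]\<^bsub>R_alg D\<^esub> N)"
    using mixed_pow_Suc[OF ij(1) _ step.prems ij(2)] step X Yc M
    by (simp add: minus_eq smult_add smult_neg smult_smult neg_smult)
  also have "\<dots> = (\<Oplus>\<^bsub>R_alg D\<^esub>p\<in>index_seqs i ?l. ?t p) \<oplus>\<^bsub>R_alg D\<^esub> (\<Oplus>\<^bsub>R_alg D\<^esub>p\<in>seqs_upto i k. ?t p)"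
    unfolding new c using step by simp
  also have "\<dots> = (\<Oplus>\<^bsub>R_alg D\<^esub>p\<in>seqs_upto i ?l. ?t p)"
    using seqs_upto_Suc[OF \<open>i \<le> k\<close>] closed sub fin finite_seqs_upto[of i k]
    by (subst finsum_Un_disjoint[symmetric]) (auto simp: Un_commute Int_commute)
  finally show ?case .
qed

text \<open>Strong induction on \<open>j\<close>, as the expansion of \<open>mixed i k j\<close>
  involves \<open>Y l i\<close> for every \<open>l\<close> strictly between \<open>i\<close> and
  \<open>j\<close>.\<close>

lemma rev_root_vector_pow:
  assumes "1 \<le> i" "i < j" "j \<le> n + 1"
  shows "Y j i [^]\<^bsub>R_alg D\<^esub> N
    = (\<Oplus>\<^bsub>R_alg D\<^esub>p\<in>index_seqs i j. t_coeff D q N i j p \<odot>\<^bsub>R_alg D\<^esub> root_power_chain D N p)"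
  using assms(2,3)
proof (induction j rule: less_induct)
  case (less j)
  obtain k where k: "j = Suc k"
    using less.prems by (cases j) auto
  have seqs: "index_seqs i j = (\<lambda>p. p @ [j]) ` seqs_upto i k"
    using index_seqs_eq_snoc[OF less.prems(1)] k by simp
  have "mixed i k j [^]\<^bsub>R_alg D\<^esub> N \<in> carrier (R_alg D)"
    using mixed_closed[of i k j] less.prems k assms(1) by simp
  \<comment> \<open>For \<open>k = j - 1\<close> the scalar is 1, and \<open>mixed i k j\<close> is
    the reverse root vector.\<close>
  then have "Y j i [^]\<^bsub>R_alg D\<^esub> N = ((- 1) ^ (j - 1 - k) * tau D N k j) \<odot>\<^bsub>R_alg D\<^esub> (mixed i k j [^]\<^bsub>R_alg D\<^esub> N)"
    using less.prems by (simp add: k rev_root_vector_eq_mixed tau_Suc one_smult)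
  also have "\<dots> = (\<Oplus>\<^bsub>R_alg D\<^esub>p\<in>seqs_upto i k.
      t_coeff D q N i j (p @ [j]) \<odot>\<^bsub>R_alg D\<^esub> root_power_chain D N (p @ [j]))"
  proof (rule mixed_pow_eq_sum)
    fix l assume l: "i < l" "l < j"
    then have "l \<le> n + 1"
      using less.prems by simp
    then show "Y l i [^]\<^bsub>R_alg D\<^esub> N =
        (\<Oplus>\<^bsub>R_alg D\<^esub>p\<in>index_seqs i l. t_coeff D q N i l p \<odot>\<^bsub>R_alg D\<^esub> root_power_chain D N p)"
      by (rule less.IH[OF l(2,1)])
  qed (use less.prems k assms(1) in auto)
  also have "\<dots> = (\<Oplus>\<^bsub>R_alg D\<^esub>p\<in>index_seqs i j. t_coeff D q N i j p \<odot>\<^bsub>R_alg D\<^esub> root_power_chain D N p)"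
    unfolding seqs using less.prems assms(1) k
    by (intro finsum_reindex[symmetric]) (auto intro!: inj_onI snoc_term_closed)
  finally show ?case .
qed

end

section \<open>The algebra \<open>R(D)\<close>\<close>

lemma mem_free_algebra:
  "f \<in> carrier (free_algebra n) \<longleftrightarrow> (\<forall>w\<in>Poly_Mapping.keys f. set (letters w) \<subseteq> {1..n})"
  by (simp add: free_algebra_def)

lemma free_algebra_simps [simp]:
  "f \<otimes>\<^bsub>free_algebra n\<^esub> g = f * g" "f \<oplus>\<^bsub>free_algebra n\<^esub> g = f + g"
  "\<one>\<^bsub>free_algebra n\<^esub> = 1" "\<zero>\<^bsub>free_algebra n\<^esub> = 0"
  by (simp_all add: free_algebra_def)

lemma letters_plus: "letters (u + v) = letters u @ letters v"
  by (simp add: plus_nc_word_def)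

lemma free_algebra_add_closed:
  "f \<in> carrier (free_algebra n) \<Longrightarrow> g \<in> carrier (free_algebra n) \<Longrightarrow> f + g \<in> carrier (free_algebra n)"
  using keys_add[of f g] by (auto simp: mem_free_algebra)

lemma free_algebra_mult_closed:
  "f \<in> carrier (free_algebra n) \<Longrightarrow> g \<in> carrier (free_algebra n) \<Longrightarrow> f * g \<in> carrier (free_algebra n)"
  using keys_mult[of f g] by (fastforce simp: mem_free_algebra letters_plus)

lemma free_algebra_uminus_closed:
  "f \<in> carrier (free_algebra n) \<Longrightarrow> - f \<in> carrier (free_algebra n)"
  by (simp add: mem_free_algebra in_keys_iff)

lemma free_algebra_minus_closed:
  "f \<in> carrier (free_algebra n) \<Longrightarrow> g \<in> carrier (free_algebra n) \<Longrightarrow> f - g \<in> carrier (free_algebra n)"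
  unfolding diff_conv_add_uminus by (intro free_algebra_add_closed free_algebra_uminus_closed)

lemma scalar_closed: "scalar c \<in> carrier (free_algebra n)"
  by (simp add: mem_free_algebra scalar_def zero_nc_word_def)

lemma xvar_closed: "i \<in> {1..n} \<Longrightarrow> xvar i \<in> carrier (free_algebra n)"
  by (simp add: mem_free_algebra xvar_def word_poly_def)

lemma ring_free_algebra: "ring (free_algebra n :: 'k::field ncpoly ring)"
proof (rule ringI)
  have 0: "(0 :: 'k ncpoly) \<in> carrier (free_algebra n)"
    by (simp add: mem_free_algebra)
  show "abelian_group (free_algebra n :: 'k ncpoly ring)"
    by (rule abelian_groupI)
      (auto simp: add_ac free_algebra_add_closed 0 intro!: bexI[OF _ free_algebra_uminus_closed])
  have 1: "(1 :: 'k ncpoly) \<in> carrier (free_algebra n)"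
    by (simp add: mem_free_algebra zero_nc_word_def)
  show "monoid (free_algebra n :: 'k ncpoly ring)"
    by (rule monoidI) (auto simp: mult.assoc free_algebra_mult_closed 1)
qed (auto simp: ring_distribs)

lemma ncpoly_expand:
  fixes f :: "'k::field ncpoly"
  shows "f = (\<Sum>w\<in>Poly_Mapping.keys f. Poly_Mapping.single w (Poly_Mapping.lookup f w))"
  by (rule poly_mapping_eqI)
    (simp add: lookup_sum lookup_single when_def if_distrib sum.delta' in_keys_iff cong: if_cong)

lemma scalar_mult_word: "scalar c * word_poly (letters w) = Poly_Mapping.single w c"
  by (cases w) (simp add: scalar_def word_poly_def mult_single)

lemma scalar_commute: "f * scalar c = scalar c * (f :: 'k::field ncpoly)"
  by (subst (1 2) ncpoly_expand[of f])
    (simp add: sum_distrib_left sum_distrib_right scalar_def mult_single mult.commute)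

lemma scalar_mult: "scalar (c * d) = scalar c * scalar d"
  by (simp add: scalar_def mult_single)

lemma scalar_add: "scalar (c + d) = scalar c + scalar d"
  by (simp add: scalar_def single_add)

text \<open>On combinations of words of one degree the braiding factor in \<open>ad_c\<close> is constant.\<close>

lemma ad_c_homogeneous:
  assumes "\<And>w. w \<in> Poly_Mapping.keys f \<Longrightarrow> (\<Prod>l\<leftarrow>letters w. braiding D i l) = c"
  shows "ad_c D i f = xvar i * f - scalar c * f * xvar i"
proof -
  have "ad_c D i f = (\<Sum>w\<in>Poly_Mapping.keys f.
      xvar i * Poly_Mapping.single w (Poly_Mapping.lookup f w)
      - scalar c * Poly_Mapping.single w (Poly_Mapping.lookup f w) * xvar i)"
    unfolding ad_c_def
  proof (rule sum.cong)
    fix w assume w: "w \<in> Poly_Mapping.keys f"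
    let ?s = "scalar (Poly_Mapping.lookup f w)" and ?w = "word_poly (letters w) :: 'a ncpoly"
    have "?s * (xvar i * ?w - scalar c * ?w * xvar i) =
        (?s * xvar i) * ?w - (?s * scalar c) * ?w * xvar i"
      by (simp add: right_diff_distrib mult.assoc)
    also have "?s * xvar i = xvar i * ?s"
      by (rule scalar_commute[symmetric])
    also have "?s * scalar c = scalar c * ?s"
      by (rule scalar_commute)
    also have "xvar i * ?s * ?w - scalar c * ?s * ?w * xvar i = xvar i * (?s * ?w) - scalar c * (?s * ?w) * xvar i"
      by (simp add: mult.assoc)
    finally show "?s * (xvar i * ?w - scalar (\<Prod>l\<leftarrow>letters w. braiding D i l) * ?w * xvar i) =
        xvar i * Poly_Mapping.single w (Poly_Mapping.lookup f w)
        - scalar c * Poly_Mapping.single w (Poly_Mapping.lookup f w) * xvar i"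
      by (simp add: assms[OF w] scalar_mult_word)
  qed simp
  also have "\<dots> = xvar i * f - scalar c * f * xvar i"
    by (simp add: sum_subtractf flip: sum_distrib_left sum_distrib_right ncpoly_expand)
  finally show ?thesis .
qed

section \<open>Serre relations in the free algebra\<close>

lemma ad_c_xvar:
  "ad_c D i (xvar j) = xvar i * xvar j - scalar (braiding D i j) * xvar j * xvar i"
  by (rule ad_c_homogeneous) (simp add: xvar_def word_poly_def)

text \<open>The inner term is supported on the words \<open>[i, j]\<close> and
  \<open>[j, i]\<close>, which have the same braiding factor.\<close>

lemma ad_c_ad_c_xvar:
  "ad_c D i (ad_c D i (xvar j)) =
    xvar i * ad_c D i (xvar j) - scalar (braiding D i i * braiding D i j) * ad_c D i (xvar j) * xvar i"
proof (rule ad_c_homogeneous)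
  fix w assume "w \<in> Poly_Mapping.keys (ad_c D i (xvar j))"
  moreover have "ad_c D i (xvar j) =
      Poly_Mapping.single (NC_Word [i, j]) 1 - Poly_Mapping.single (NC_Word [j, i]) (braiding D i j)"
    unfolding ad_c_xvar
    by (simp add: xvar_def word_poly_def scalar_def mult_single plus_nc_word_def zero_nc_word_def)
  ultimately have "w = NC_Word [i, j] \<or> w = NC_Word [j, i]"
    by (auto simp: in_keys_iff lookup_minus lookup_single when_def split: if_splits)
  then show "(\<Prod>l\<leftarrow>letters w. braiding D i l) = braiding D i i * braiding D i j"
    by (auto simp: mult.commute)
qed

lemma ad_c_xvar_closed:
  "i \<in> {1..n} \<Longrightarrow> j \<in> {1..n} \<Longrightarrow> ad_c D i (xvar j) \<in> carrier (free_algebra n)"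
  unfolding ad_c_xvar
  by (intro free_algebra_minus_closed free_algebra_mult_closed scalar_closed xvar_closed)

lemma serre_relation_far:
  assumes "Suc i < j \<or> Suc j < i"
  shows "(ad_c D i ^^ nat (1 - cartan_A i j)) (xvar j) = ad_c D i (xvar j)"
  using assms by (auto simp: cartan_A_def)

lemma serre_relation_near:
  assumes "i = Suc j \<or> j = Suc i"
  shows "(ad_c D i ^^ nat (1 - cartan_A i j)) (xvar j) = ad_c D i (ad_c D i (xvar j))"
  using assms by (auto simp: cartan_A_def numeral_2_eq_2)

lemma serre_relations_closed: "serre_relations D \<subseteq> carrier (free_algebra (datum_rank D))"
proof
  fix r assume "r \<in> serre_relations D"
  then obtain i j where r: "r = (ad_c D i ^^ nat (1 - cartan_A i j)) (xvar j)"
    and ij: "i \<in> {1..datum_rank D}" "j \<in> {1..datum_rank D}" "i \<noteq> j"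
    by (auto simp: serre_relations_def)
  consider "Suc i < j \<or> Suc j < i" | "i = Suc j \<or> j = Suc i"
    using ij(3) by linarith
  then show "r \<in> carrier (free_algebra (datum_rank D))"
  proof cases
    case 1
    then show ?thesis
      unfolding r serre_relation_far[OF 1] using ij by (intro ad_c_xvar_closed)
  next
    case 2
    then show ?thesis
      unfolding r serre_relation_near[OF 2] ad_c_ad_c_xvar[of D i j] using ij
      by (intro free_algebra_minus_closed free_algebra_mult_closed scalar_closed xvar_closed ad_c_xvar_closed)
  qed
qed

lemma ideal_serre_ideal: "ideal (serre_ideal D) (free_algebra (datum_rank D))"
  unfolding serre_ideal_def
  by (intro ring.genideal_ideal ring_free_algebra serre_relations_closed)

section \<open>The quotient and its scalar action\<close>

abbreviation free_quotient :: "('g, 'k::field) datum \<Rightarrow> 'k ncpoly set ring"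
  where "free_quotient D \<equiv> free_algebra (datum_rank D) Quot serre_ideal D"

lemma R_alg_simps:
  "carrier (R_alg D) = carrier (free_quotient D)"
  "x \<otimes>\<^bsub>R_alg D\<^esub> y = x \<otimes>\<^bsub>free_quotient D\<^esub> y"
  "x \<oplus>\<^bsub>R_alg D\<^esub> y = x \<oplus>\<^bsub>free_quotient D\<^esub> y"
  "\<one>\<^bsub>R_alg D\<^esub> = \<one>\<^bsub>free_quotient D\<^esub>"
  "\<zero>\<^bsub>R_alg D\<^esub> = \<zero>\<^bsub>free_quotient D\<^esub>"
  "c \<odot>\<^bsub>R_alg D\<^esub> x = cls D (scalar c) \<otimes>\<^bsub>free_quotient D\<^esub> x"
  by (simp_all add: R_alg_def Let_def ring.defs module.defs)

lemma ring_R_alg: "ring (R_alg D)"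
proof -
  interpret Q: ring "free_quotient D"
    by (rule ideal.quotient_is_ring[OF ideal_serre_ideal])
  show ?thesis
  proof (rule ringI)
    show "abelian_group (R_alg D)"
      by (rule abelian_groupI) (auto simp: R_alg_simps Q.a_ac intro!: bexI[OF _ Q.a_inv_closed] Q.l_neg)
    show "monoid (R_alg D)"
      by (rule monoidI) (auto simp: R_alg_simps Q.m_assoc)
  qed (auto simp: R_alg_simps Q.l_distr Q.r_distr)
qed

lemma cls_ring_hom: "cls D \<in> ring_hom (free_algebra (datum_rank D)) (R_alg D)"
  using ideal.rcos_ring_hom[OF ideal_serre_ideal[of D]]
  by (auto simp: ring_hom_def R_alg_simps cls_def[abs_def])

lemma R_alg_carrierE:
  assumes "x \<in> carrier (R_alg D)"
  obtains f where "f \<in> carrier (free_algebra (datum_rank D))" "x = cls D f"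
  using assms by (auto simp: R_alg_simps FactRing_def A_RCOSETS_def' cls_def)

context
  fixes D :: "('g, 'k::field) datum"
begin

private abbreviation (input) "F \<equiv> free_algebra (datum_rank D) :: 'k ncpoly ring"

lemma cls_closed: "f \<in> carrier F \<Longrightarrow> cls D f \<in> carrier (R_alg D)"
  by (rule ring_hom_closed[OF cls_ring_hom])

lemma cls_mult: "f \<in> carrier F \<Longrightarrow> g \<in> carrier F \<Longrightarrow> cls D (f * g) = cls D f \<otimes>\<^bsub>R_alg D\<^esub> cls D g"
  using ring_hom_mult[OF cls_ring_hom, of f D g] by simp

lemma cls_add: "f \<in> carrier F \<Longrightarrow> g \<in> carrier F \<Longrightarrow> cls D (f + g) = cls D f \<oplus>\<^bsub>R_alg D\<^esub> cls D g"
  using ring_hom_add[OF cls_ring_hom, of f D g] by simp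

lemma cls_one: "cls D 1 = \<one>\<^bsub>R_alg D\<^esub>"
  using ring_hom_one[OF cls_ring_hom, of D] by simp

lemma smult_eq: "c \<odot>\<^bsub>R_alg D\<^esub> x = cls D (scalar c) \<otimes>\<^bsub>R_alg D\<^esub> x"
  by (simp add: R_alg_simps)

text \<open>A scalar acts as multiplication by the class of a constant, and constants are central by
  \<open>scalar_commute\<close>.\<close>

lemma scalar_ring_R_alg: "scalar_ring (R_alg D)"
proof -
  interpret ring "R_alg D"
    by (rule ring_R_alg)
  have S [simp]: "cls D (scalar c) \<in> carrier (R_alg D)" for c
    by (intro cls_closed scalar_closed)
  have comm: "x \<otimes>\<^bsub>R_alg D\<^esub> cls D (scalar c) = cls D (scalar c) \<otimes>\<^bsub>R_alg D\<^esub> x"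
    if "x \<in> carrier (R_alg D)" for x c
    using that by (elim R_alg_carrierE) (simp add: scalar_commute scalar_closed flip: cls_mult)
  show ?thesis
  proof
    fix c d :: 'k and x y
    assume x [simp]: "x \<in> carrier (R_alg D)" 
    show "c \<odot>\<^bsub>R_alg D\<^esub> x \<in> carrier (R_alg D)"
      by (simp add: smult_eq)
    show "(c + d) \<odot>\<^bsub>R_alg D\<^esub> x = c \<odot>\<^bsub>R_alg D\<^esub> x \<oplus>\<^bsub>R_alg D\<^esub> d \<odot>\<^bsub>R_alg D\<^esub> x"
      by (simp add: smult_eq scalar_add cls_add scalar_closed l_distr)
    show "c \<odot>\<^bsub>R_alg D\<^esub> (d \<odot>\<^bsub>R_alg D\<^esub> x) = (c * d) \<odot>\<^bsub>R_alg D\<^esub> x"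
      by (simp add: smult_eq scalar_mult cls_mult scalar_closed m_assoc)
    have "scalar 1 = (1 :: 'k ncpoly)"
      by (simp add: scalar_def)
    then show "1 \<odot>\<^bsub>R_alg D\<^esub> x = x"
      by (simp add: smult_eq cls_one)
    assume y [simp]: "y \<in> carrier (R_alg D)"
    show "c \<odot>\<^bsub>R_alg D\<^esub> (x \<oplus>\<^bsub>R_alg D\<^esub> y) = c \<odot>\<^bsub>R_alg D\<^esub> x \<oplus>\<^bsub>R_alg D\<^esub> c \<odot>\<^bsub>R_alg D\<^esub> y"
      by (simp add: smult_eq r_distr)
    show "c \<odot>\<^bsub>R_alg D\<^esub> x \<otimes>\<^bsub>R_alg D\<^esub> y = c \<odot>\<^bsub>R_alg D\<^esub> (x \<otimes>\<^bsub>R_alg D\<^esub> y)"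
      by (simp add: smult_eq m_assoc)
    have "x \<otimes>\<^bsub>R_alg D\<^esub> (cls D (scalar c) \<otimes>\<^bsub>R_alg D\<^esub> y) = (x \<otimes>\<^bsub>R_alg D\<^esub> cls D (scalar c)) \<otimes>\<^bsub>R_alg D\<^esub> y"
      by (simp add: m_assoc)
    then show "x \<otimes>\<^bsub>R_alg D\<^esub> (c \<odot>\<^bsub>R_alg D\<^esub> y) = c \<odot>\<^bsub>R_alg D\<^esub> (x \<otimes>\<^bsub>R_alg D\<^esub> y)"
      by (simp add: smult_eq comm m_assoc)
  qed
qed

interpretation R: scalar_ring "R_alg D"
  by (rule scalar_ring_R_alg)

lemma cls_minus_eq_zeroD:
  assumes "f \<in> carrier F" "g \<in> carrier F" "f - g \<in> serre_ideal D"
  shows "cls D f = cls D g"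
proof -
  interpret I: ideal "serre_ideal D" F
    by (rule ideal_serre_ideal)
  have "cls D f = cls D (f - g) \<oplus>\<^bsub>R_alg D\<^esub> cls D g"
    using assms by (simp add: free_algebra_minus_closed flip: cls_add)
  also have "cls D (f - g) = \<zero>\<^bsub>R_alg D\<^esub>"
    using assms(3) I.a_rcos_const[of "f - g"] by (simp add: cls_def R_alg_simps FactRing_def)
  finally show ?thesis
    using assms cls_closed by simp
qed

section \<open>Relations between the generators of \<open>R_alg D\<close>\<close>

lemma gen_closed: "i \<in> {1..datum_rank D} \<Longrightarrow> gen D i \<in> carrier (R_alg D)"
  unfolding gen_def by (intro cls_closed xvar_closed)

lemma serre_relation_mem:
  assumes "i \<in> {1..datum_rank D}" "j \<in> {1..datum_rank D}" "i \<noteq> j"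
  shows "(ad_c D i ^^ nat (1 - cartan_A i j)) (xvar j) \<in> serre_ideal D"
  unfolding serre_ideal_def
  using ring.genideal_self[OF ring_free_algebra serre_relations_closed, of D] assms
  by (auto simp: serre_relations_def)

lemma gen_qcomm:
  assumes "i \<in> {1..datum_rank D}" "j \<in> {1..datum_rank D}" "Suc i < j"
  shows "R.qcomm (braiding D i j) (gen D i) (gen D j)"
proof -
  have "xvar i * xvar j - scalar (braiding D i j) * (xvar j * xvar i) \<in> serre_ideal D"
    using serre_relation_mem[of i j] assms by (simp add: serre_relation_far ad_c_xvar mult.assoc)
  then have "cls D (xvar i * xvar j) = cls D (scalar (braiding D i j) * (xvar j * xvar i))"
    using assms by (intro cls_minus_eq_zeroD free_algebra_mult_closed scalar_closed xvar_closed)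
  then show ?thesis
    using assms by (simp add: R.qcomm_def smult_eq gen_def cls_mult free_algebra_mult_closed scalar_closed xvar_closed)
qed

lemma cls_ad_c:
  assumes "i \<in> {1..datum_rank D}" "j \<in> {1..datum_rank D}"
  shows "cls D (ad_c D i (xvar j)) = R.br (braiding D i j) (gen D i) (gen D j)"
proof -
  have "gen D i \<otimes>\<^bsub>R_alg D\<^esub> gen D j =
      cls D (ad_c D i (xvar j) + scalar (braiding D i j) * (xvar j * xvar i))"
    using assms by (simp add: gen_def ad_c_xvar mult.assoc xvar_closed flip: cls_mult)
  also have "\<dots> = cls D (ad_c D i (xvar j)) \<oplus>\<^bsub>R_alg D\<^esub> braiding D i j \<odot>\<^bsub>R_alg D\<^esub> (gen D j \<otimes>\<^bsub>R_alg D\<^esub> gen D i)"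
    using assms
    by (simp add: cls_add cls_mult ad_c_xvar_closed free_algebra_mult_closed scalar_closed xvar_closed smult_eq gen_def)
  finally have eq: "gen D i \<otimes>\<^bsub>R_alg D\<^esub> gen D j =
      cls D (ad_c D i (xvar j)) \<oplus>\<^bsub>R_alg D\<^esub> braiding D i j \<odot>\<^bsub>R_alg D\<^esub> (gen D j \<otimes>\<^bsub>R_alg D\<^esub> gen D i)" .
  have "cls D (ad_c D i (xvar j)) \<in> carrier (R_alg D)" "gen D i \<in> carrier (R_alg D)" "gen D j \<in> carrier (R_alg D)"
    using assms by (auto intro!: cls_closed ad_c_xvar_closed gen_closed)
  then show ?thesis
    by (simp add: R.br_def eq R.minus_eq R.a_assoc R.r_neg)
qed

text \<open>The cubic Serre relation read as a skew commutation with the inner commutator, in either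
  order of the adjacent indices.\<close>

lemma gen_qcomm_br:
  assumes "i \<in> {1..datum_rank D}" "j \<in> {1..datum_rank D}" "i = Suc j \<or> j = Suc i"
  shows "R.qcomm (braiding D i i * braiding D i j) (gen D i) (R.br (braiding D i j) (gen D i) (gen D j))"
proof -
  let ?f = "ad_c D i (xvar j)"
  have "xvar i * ?f - scalar (braiding D i i * braiding D i j) * (?f * xvar i) \<in> serre_ideal D"
    using serre_relation_mem[of i j] assms(1,2) serre_relation_near[OF assms(3), of D] assms(3)
    by (auto simp: ad_c_ad_c_xvar mult.assoc)
  then have "cls D (xvar i * ?f) = cls D (scalar (braiding D i i * braiding D i j) * (?f * xvar i))"
    using assms by (intro cls_minus_eq_zeroD free_algebra_mult_closed scalar_closed xvar_closed ad_c_xvar_closed)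
  then show ?thesis
    using assms
    by (simp add: R.qcomm_def smult_eq gen_def cls_mult free_algebra_mult_closed scalar_closed
        xvar_closed ad_c_xvar_closed flip: cls_ad_c[unfolded gen_def])
qed

end

lemma type_A_datumI:
  assumes "datum_of_type_A D q N"
  shows "type_A_datum D q N"
proof -
  interpret R: scalar_ring "R_alg D"
    by (rule scalar_ring_R_alg)
  show ?thesis
  proof
    fix i assume i: "i \<in> {1..datum_rank D}" "Suc i \<in> {1..datum_rank D}"
    have q: "braiding D i i = q" "braiding D (Suc i) (Suc i) = q"
      and inv: "braiding D i (Suc i) * braiding D (Suc i) i = inverse q"
      using assms i unfolding datum_of_type_A_def by blast+
    have "q \<noteq> 0"
      using assms by (auto simp: datum_of_type_A_def root_of_unity_of_order_def zero_power)
    then have "q * braiding D i (Suc i) * braiding D (Suc i) i = 1"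
      by (simp add: inv mult.assoc)
    \<comment> \<open>The Serre relation for the pair \<open>Suc i\<close>, \<open>i\<close> becomes
      the second conjunct of \<open>serre2\<close> through \<open>qcomm_br_iff\<close>.\<close>
    then have "R.qcomm (q * braiding D i (Suc i)) (R.br (braiding D i (Suc i)) (gen D i) (gen D (Suc i))) (gen D (Suc i))"
      using gen_qcomm_br[of "Suc i" D i] i q(2) gen_closed[of _ D] by (subst R.qcomm_br_iff) auto
    then show "R.serre2 q (braiding D i (Suc i)) (gen D i) (gen D (Suc i))"
      using gen_qcomm_br[of i D "Suc i"] i q(1) by (simp add: R.serre2_def)
  qed (use assms in \<open>auto intro: gen_closed gen_qcomm\<close>)
qed

theorem theorem3p1:
  fixes D :: "('g, 'k::{alg_closed_field, field_char_0}) datum"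
    and q :: 'k and N i j :: nat
  assumes "datum_of_type_A D q N"
    and "1 \<le> i" and "i < j" and "j \<le> datum_rank D + 1"
  shows "rev_root_vector D j i [^]\<^bsub>R_alg D\<^esub> N
    = (\<Oplus>\<^bsub>R_alg D\<^esub>p\<in>index_seqs i j. t_coeff D q N i j p \<odot>\<^bsub>R_alg D\<^esub> root_power_chain D N p)"
  by (rule type_A_datum.rev_root_vector_pow[OF type_A_datumI]) (use assms in auto)

end
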